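(* Let $K$ be a knot. Then: (1) $K$ is the trivial knot if and only if $\mathrm{spn}(K)=0$; (2) $K$ is a non-trivial alternating knot if and only if $\mathrm{spn}(K)=1$.
   Context: All knots and knot diagrams are oriented, and diagrams lie on $S^2$. A base point $b$ of a knot diagram $D$ is a point of $D$ that is not a crossing point. A crossing point of $D$ is a warping crossing point of $D_b=(D,b)$ if, going along $D$ following its orientation starting from $b$, one meets that crossing first as an under-crossing. The warping degree $d(D_b)$ is the number of warping crossing points of $D_b$. An edge of $D$ is a path on $D$ between (consecutive) crossing points with no crossings in its interior; for the diagram with no crossings, the whole circle counts as one edge. The warping degree $i(e)$ of an edge $e$ is $d(D_b)$ for any base point $b$ on $e$. The warping polynomial of $D$ is $W_D(t)=\sum_e t^{i(e)}$, the sum over all edges $e$ of $D$. The span of $D$, $\mathrm{spn}(D)$, is the difference between the highest and lowest degrees of terms of $W_D(t)$; equivalently $\mathrm{spn}(D)=\max_b d(D_b)-\min_b d(D_b)$. The span $\mathrm{spn}(K)$ of a knot $K$ is the minimum of $\mathrm{spn}(D)$ over all diagrams $D$ of $K$. A diagram is alternating if over- and under-crossings alternate along it; a knot is alternating if it has an alternating diagram. *)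

theory Defs
  imports
    "HOL-Analysis.Analysis"
    "HOL-Library.Extended_Nat"
    "HOL-Computational_Algebra.Polynomial"
begin

(* Knots are oriented tame knots in 3-space, presented as oriented closed polygons.  Ambient
   3-space is complex * real: fst is the projection to the plane of the diagram, snd the height
   above that plane. *)
type_synonym space = "complex \<times> real"

(* The closed polygon with the cyclic list of vertices P, traversed with period (length P) in the
   order of the list; the side from P!k to the next vertex is run through on [k, k+1]. *)
definition curve :: "space list \<Rightarrow> real \<Rightarrow> space" where
  "curve P t =
     linepath (P ! nat (\<lfloor>t\<rfloor> mod int (length P))) (P ! nat ((\<lfloor>t\<rfloor> + 1) mod int (length P))) (frac t)"

(* Injectivity on one period forces at least three vertices.  Consecutive collinear vertices
   (subdivided sides) are allowed. *)
definition polygonal_knot :: "space list \<Rightarrow> bool" where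
  "polygonal_knot P \<longleftrightarrow> P \<noteq> [] \<and> inj_on (curve P) {0..<real (length P)}"

(* The elementary (Delta) move: the side ab of P is replaced by the two sides ac and cb of a
   triangle that meets P in the side ab only.  The triangle may be degenerate, with c on the side
   ab (subdivision). *)
definition triangle_move :: "space list \<Rightarrow> space list \<Rightarrow> bool" where
  "triangle_move P Q \<longleftrightarrow>
     polygonal_knot P \<and> polygonal_knot Q \<and>
     (\<exists>a b c rest. P = a # b # rest \<and> Q = a # c # b # rest \<and>
        convex hull {a, b, c} \<inter> range (curve P) = closed_segment a b)"

(* Equivalence of oriented polygonal knots, generated by elementary moves and their inverses.
   Rotating the list only changes the vertex at which the traversal starts. *)
definition knot_equiv :: "space list \<Rightarrow> space list \<Rightarrow> bool" where
  "knot_equiv = equivclp (\<lambda>P Q. triangle_move P Q \<or> Q = rotate1 P)"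

(* [a, b, c] is a polygonal knot exactly if a, b, c are not collinear. *)
definition trivial_knot :: "space list \<Rightarrow> bool" where
  "trivial_knot K \<longleftrightarrow> (\<exists>a b c. polygonal_knot [a, b, c] \<and> knot_equiv K [a, b, c])"

definition shadow :: "space list \<Rightarrow> real \<Rightarrow> complex" where
  "shadow P t = fst (curve P t)"

definition crossings :: "space list \<Rightarrow> complex set" where
  "crossings P =
     {x. \<exists>p \<in> range (curve P). \<exists>q \<in> range (curve P). p \<noteq> q \<and> fst p = x \<and> fst q = x}"

(* A diagram is a polygonal knot in regular position: the projection has finitely many multiple
   points, all of them are double points, and none of them is the image of a vertex.  (The double
   points are then transversal, and no side is vertical.)  The diagram proper consists of the
   shadow and the over/under information, and everything below depends only on these.

   The plane is the sphere S^2 without one point: a diagram on S^2 can be moved off the point at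
   infinity by an isotopy of S^2, which changes neither the knot nor any notion below. *)
definition knot_diagram :: "space list \<Rightarrow> bool" where
  "knot_diagram D \<longleftrightarrow>
     polygonal_knot D \<and> finite (crossings D) \<and>
     (\<forall>x \<in> crossings D. card {p \<in> range (curve D). fst p = x} = 2 \<and> x \<notin> fst ` set D)"

definition diagram_of :: "space list \<Rightarrow> space list \<Rightarrow> bool" where
  "diagram_of D K \<longleftrightarrow> knot_diagram D \<and> knot_equiv D K"

(* At parameter t the diagram passes a crossing on the lower strand. *)
definition under_at :: "space list \<Rightarrow> real \<Rightarrow> bool" where
  "under_at D t \<longleftrightarrow> (\<exists>p \<in> range (curve D). fst p = shadow D t \<and> snd (curve D t) < snd p)"

(* b is a base point, i.e. a point of the shadow that is not a crossing; t is the first time after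
   the departure from b at which the crossing c is met. *)
definition warping_crossing :: "space list \<Rightarrow> complex \<Rightarrow> complex \<Rightarrow> bool" where
  "warping_crossing D b c \<longleftrightarrow>
     c \<in> crossings D \<and>
     (\<exists>s t. s < t \<and> shadow D s = b \<and> shadow D t = c \<and> (\<forall>r \<in> {s<..<t}. shadow D r \<noteq> c) \<and>
        under_at D t)"

definition warping_degree :: "space list \<Rightarrow> complex \<Rightarrow> nat" where
  "warping_degree D b = card {c. warping_crossing D b c}"

definition consecutive_crossings :: "space list \<Rightarrow> real \<Rightarrow> real \<Rightarrow> bool" where
  "consecutive_crossings D s t \<longleftrightarrow>
     s < t \<and> shadow D s \<in> crossings D \<and> shadow D t \<in> crossings D \<and>
     (\<forall>r \<in> {s<..<t}. shadow D r \<notin> crossings D)"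

(* Edges without their end points, so that every point of an edge is a base point. *)
definition diagram_edges :: "space list \<Rightarrow> complex set set" where
  "diagram_edges D =
     (if crossings D = {} then {range (shadow D)}
      else {shadow D ` {s<..<t} | s t. consecutive_crossings D s t})"

(* The warping degree is the same at all points of an edge, so any choice of b will do. *)
definition edge_warping_degree :: "space list \<Rightarrow> complex set \<Rightarrow> nat" where
  "edge_warping_degree D e = warping_degree D (SOME b. b \<in> e)"

definition warping_polynomial :: "space list \<Rightarrow> int poly" where
  "warping_polynomial D = (\<Sum>e \<in> diagram_edges D. monom 1 (edge_warping_degree D e))"

definition diagram_span :: "space list \<Rightarrow> nat" where
  "diagram_span D =
     Max {k. coeff (warping_polynomial D) k \<noteq> 0} - Min {k. coeff (warping_polynomial D) k \<noteq> 0}"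

(* Being an infimum in enat, this is attained, i.e. a minimum, as soon as K has a diagram. *)
definition knot_span :: "space list \<Rightarrow> enat" where
  "knot_span K = (INF D \<in> {D. diagram_of D K}. enat (diagram_span D))"

definition alternating_diagram :: "space list \<Rightarrow> bool" where
  "alternating_diagram D \<longleftrightarrow>
     knot_diagram D \<and> (\<forall>s t. consecutive_crossings D s t \<longrightarrow> (under_at D s \<longleftrightarrow> \<not> under_at D t))"

definition alternating_knot :: "space list \<Rightarrow> bool" where
  "alternating_knot K \<longleftrightarrow> (\<exists>D. diagram_of D K \<and> alternating_diagram D)"

end

theory Submission
  imports Defs
begin

text \<open>
  Both statements reduce to facts about a single diagram \<open>D\<close>:

    \<^item> \<open>D\<close> has span \<open>0\<close> if and only if it has no crossings (\<open>span_zero_iff\<close>);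
    \<^item> a diagram of span \<open>1\<close> is alternating (\<open>span_one_alternating\<close>), and an alternating diagram has span at
      most \<open>1\<close> (\<open>alternating_span_le_one\<close>);
    \<^item> a knot is trivial if and only if it has a diagram without crossings
      (\<open>trivial_knot_iff_crossingless_diagram\<close>).

  The span of a knot is a minimum over its diagrams, so it is \<open>0\<close> exactly for trivial knots.  A non-trivial
  knot has span at least \<open>1\<close>, with equality exactly if some diagram has span \<open>1\<close>, that is, exactly if
  the knot is alternating.

  The facts about spans rest on one observation (\<open>warping_after_crossing\<close>): when the base point moves
  forward past a crossing, the warping degree drops by one if the passage is an under-crossing and grows by one
  if it is an over-crossing.  Hence it is not constant as soon as there is a crossing; it stays within two
  consecutive values if over and under alternate; and two consecutive passages of the same kind produce three
  different values.

  That a knot over a simple closed polygon is trivial is proved without the Jordan curve theorem and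
  without triangulating the polygon (\<open>simple_shadow_trivial\<close>).  Over a simple shadow the
  heights of the vertices are irrelevant: vertical triangles never hit the rest of the knot.  Hence
  the knot may be assumed to rise monotonically from its first vertex and to come back along a
  vertical side.  If the first vertex is chosen over an extreme point of the shadow, the
  following vertices can be cut off one at a time, since height separates the triangle that is cut off from
  the rising part, and extremality separates it from the vertical side.  Conversely, every
  triangle in space can be moved to one whose projection is a proper triangle.
\<close>


section \<open>Closed polygons as chains of sides\<close>

text \<open>
  Sides contain their start but not their end.  In this way every point of a closed polygon is
  counted once, and injectivity on a period becomes disjointness of sides.
\<close>
definition side :: "'a::real_normed_vector \<Rightarrow> 'a \<Rightarrow> 'a set" where
  "side a b = linepath a b ` {0..<1}"

text \<open>
  The last vertex is left out.  A closed polygon \<open>P\<close> is therefore \<open>chain (P @ [hd P])\<close>: the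
  final side returns to the first vertex, which the first side already contains.
\<close>
definition chain :: "'a::real_normed_vector list \<Rightarrow> 'a set" where
  "chain ws = (\<Union>(a, b)\<in>set (zip ws (tl ws)). side a b)"

definition simple_chain :: "'a::real_normed_vector list \<Rightarrow> bool" where
  "simple_chain ws \<longleftrightarrow> (\<forall>(a, b)\<in>set (zip ws (tl ws)). a \<noteq> b) \<and>
     sorted_wrt (\<lambda>(a, b) (c, d). side a b \<inter> side c d = {}) (zip ws (tl ws))"

lemma chain_simps [simp]:
  "chain [] = {}" "chain [a] = {}" "chain (a # b # ws) = side a b \<union> chain (b # ws)"
  by (auto simp: chain_def)

lemma simple_chain_simps [simp]:
  "simple_chain []" "simple_chain [a]"
  "simple_chain (a # b # ws) \<longleftrightarrow> a \<noteq> b \<and> side a b \<inter> chain (b # ws) = {} \<and> simple_chain (b # ws)"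
  by (auto simp: simple_chain_def chain_def)

lemma zip_tl_snoc: "zip (ws @ [a, b]) (tl (ws @ [a, b])) = zip (ws @ [a]) (tl (ws @ [a])) @ [(a, b)]"
  by (induction ws rule: induct_list012) auto

lemma chain_snoc: "chain (ws @ [a, b]) = chain (ws @ [a]) \<union> side a b"
  unfolding chain_def zip_tl_snoc by auto

lemma simple_chain_snoc:
  "simple_chain (ws @ [a, b]) \<longleftrightarrow>
     simple_chain (ws @ [a]) \<and> a \<noteq> b \<and> chain (ws @ [a]) \<inter> side a b = {}"
  unfolding simple_chain_def chain_def zip_tl_snoc by (auto simp: sorted_wrt_append)

lemma chain_nth: "chain ws = (\<Union>i<length ws - 1. side (ws ! i) (ws ! Suc i))"
  by (auto simp: chain_def set_zip nth_tl)

lemma simple_chain_nth: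
  "simple_chain ws \<longleftrightarrow> (\<forall>i<length ws - 1. ws ! i \<noteq> ws ! Suc i) \<and>
     (\<forall>i j. i < j \<and> j < length ws - 1 \<longrightarrow> side (ws ! i) (ws ! Suc i) \<inter> side (ws ! j) (ws ! Suc j) = {})"
proof -
  have "zip ws (tl ws) ! i = (ws ! i, ws ! Suc i)" if "i < length ws - 1" for i
    using that by (simp add: nth_tl)
  then show ?thesis
    unfolding simple_chain_def sorted_wrt_iff_nth_less all_set_conv_all_nth by simp blast
qed

text \<open>
  The curve of a knot, with vertices in any normed space: the shadow of a knot is then the path of
  the polygon of projected vertices, so that the same criterion for injectivity serves both.
\<close>
definition polygon_path :: "'a::real_normed_vector list \<Rightarrow> real \<Rightarrow> 'a" where
  "polygon_path P t =
     linepath (P ! nat (\<lfloor>t\<rfloor> mod int (length P))) (P ! nat ((\<lfloor>t\<rfloor> + 1) mod int (length P))) (frac t)"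

lemma curve_eq_polygon_path: "curve P = polygon_path P"
  by (simp add: fun_eq_iff curve_def polygon_path_def)

lemma shadow_eq_polygon_path:
  assumes "P \<noteq> []"
  shows "shadow P = polygon_path (map fst P)"
proof
  fix t
  have "nat (k mod int (length P)) < length P" for k :: int
    using assms by (simp add: nat_less_iff)
  then show "shadow P t = polygon_path (map fst P) t"
    by (simp add: shadow_def curve_def polygon_path_def linepath_def)
qed

lemma polygon_path_periodic: "polygon_path P (t + of_int k * real (length P)) = polygon_path P t"
proof -
  have "\<lfloor>t + of_int k * real (length P)\<rfloor> = \<lfloor>t\<rfloor> + k * int (length P)"
    by (metis floor_add_int of_int_mult of_int_of_nat_eq)
  moreover have "frac (t + of_int k * real (length P)) = frac t"
    by (metis frac_add_int_right of_int_mult of_int_of_nat_eq Ints_of_int)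
  moreover have "(\<lfloor>t\<rfloor> + k * int (length P) + 1) mod int (length P) = (\<lfloor>t\<rfloor> + 1) mod int (length P)"
    using mod_mult_self1[of "\<lfloor>t\<rfloor> + 1" k "int (length P)"] by (simp only: ac_simps)
  ultimately show ?thesis
    by (simp only: polygon_path_def mod_mult_self1)
qed

lemma polygon_path_on_side:
  assumes "i < length P" "0 \<le> s" "s < 1"
  shows "polygon_path P (real i + s) = linepath ((P @ [hd P]) ! i) ((P @ [hd P]) ! Suc i) s"
proof -
  have fl: "\<lfloor>real i + s\<rfloor> = int i" using assms by linarith
  have fr: "frac (real i + s) = s" by (simp add: frac_def fl)
  have "nat ((int i + 1) mod int (length P)) = Suc i mod length P"
    by (metis add.commute nat_int of_nat_Suc zmod_int)
  moreover have "P ! (Suc i mod length P) = (P @ [hd P]) ! Suc i"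
  proof (cases "Suc i < length P")
    case False
    then have "Suc i = length P" using assms by simp
    moreover have "P \<noteq> []" using assms by auto
    ultimately show ?thesis by (simp add: hd_conv_nth nth_append)
  qed (simp add: nth_append)
  ultimately show ?thesis
    using assms by (simp add: polygon_path_def fl fr nth_append)
qed

lemma range_polygon_path:
  assumes "P \<noteq> []"
  shows "range (polygon_path P) = chain (P @ [hd P])"
proof
  have n: "length P > 0" using assms by simp
  show "range (polygon_path P) \<subseteq> chain (P @ [hd P])"
  proof
    fix p assume "p \<in> range (polygon_path P)"
    then obtain t where t: "p = polygon_path P t" by auto
    define k where "k = \<lfloor>t / real (length P)\<rfloor>"
    define u where "u = t - of_int k * real (length P)"
    have pu: "p = polygon_path P u"
      using polygon_path_periodic[of P u k] by (simp add: t u_def)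
    have u: "0 \<le> u" "u < real (length P)"
      using n floor_divide_lower[of "real (length P)" t] floor_divide_upper[of "real (length P)" t]
      by (auto simp: u_def k_def algebra_simps)
    define i where "i = nat \<lfloor>u\<rfloor>"
    have i: "real i \<le> u" "u < real i + 1" unfolding i_def using u by linarith+
    then have il: "i < length P" using u by linarith
    have "p = linepath ((P @ [hd P]) ! i) ((P @ [hd P]) ! Suc i) (u - real i)"
      using polygon_path_on_side[OF il, of "u - real i"] i pu by simp
    then show "p \<in> chain (P @ [hd P])"
      unfolding chain_nth side_def using il i by (intro UN_I[of i]) auto
  qed
  show "chain (P @ [hd P]) \<subseteq> range (polygon_path P)"
  proof
    fix p assume "p \<in> chain (P @ [hd P])"
    then obtain i s where "i < length P" "0 \<le> s" "s < 1"
      "p = linepath ((P @ [hd P]) ! i) ((P @ [hd P]) ! Suc i) s"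
      by (auto simp: chain_nth side_def)
    then show "p \<in> range (polygon_path P)"
      using polygon_path_on_side[of i P s] by (metis rangeI)
  qed
qed

text \<open>
  The integer part of the parameter selects a side and the fractional part a point on it, so two
  parameters with the same image come either from one degenerate side or from two sides that meet.
\<close>
lemma inj_polygon_path_iff:
  assumes "P \<noteq> []"
  shows "inj_on (polygon_path P) {0..<real (length P)} \<longleftrightarrow> simple_chain (P @ [hd P])"
proof
  let ?W = "P @ [hd P]"
  assume inj: "inj_on (polygon_path P) {0..<real (length P)}"
  have key: "i = j \<and> s = r"
    if "i < length P" "j < length P" "s \<in> {0..<1}" "r \<in> {0..<1}"
      "linepath (?W ! i) (?W ! Suc i) s = linepath (?W ! j) (?W ! Suc j) r" for i j s r
  proof -
    have "real i + s = real j + r"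
      using that by (intro inj_onD[OF inj]) (auto simp: polygon_path_on_side)
    then have "i = j" using that by simp
    then show ?thesis using \<open>real i + s = real j + r\<close> by simp
  qed
  show "simple_chain ?W"
    unfolding simple_chain_nth
  proof (intro conjI allI impI)
    fix i assume i: "i < length ?W - 1"
    show "?W ! i \<noteq> ?W ! Suc i"
      using key[of i i 0 "1/2"] i by auto
  next
    fix i j assume ij: "i < j \<and> j < length ?W - 1"
    show "side (?W ! i) (?W ! Suc i) \<inter> side (?W ! j) (?W ! Suc j) = {}"
      unfolding side_def using key[of i j] ij by fastforce
  qed
next
  let ?W = "P @ [hd P]"
  assume S: "simple_chain ?W"
  have le: "t = u" if tu: "0 \<le> t" "t < real (length P)" "0 \<le> u" "u < real (length P)" "t \<le> u"
    "polygon_path P t = polygon_path P u" for t u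
  proof -
    define i where "i = nat \<lfloor>t\<rfloor>"
    define j where "j = nat \<lfloor>u\<rfloor>"
    have i: "real i \<le> t" "t < real i + 1" unfolding i_def using tu by linarith+
    have j: "real j \<le> u" "u < real j + 1" unfolding j_def using tu by linarith+
    have ij: "i \<le> j" "j < length P" "i < length P" using i j tu by linarith+
    have eq: "linepath (?W ! i) (?W ! Suc i) (t - real i) = linepath (?W ! j) (?W ! Suc j) (u - real j)"
      using polygon_path_on_side[of i P "t - real i"] polygon_path_on_side[of j P "u - real j"] ij i j tu by simp
    show "t = u"
    proof (cases "i = j")
      case True
      have "inj_on (linepath (?W ! i) (?W ! Suc i)) {0..1}"
        using S ij by (intro inj_on_linepath) (auto simp: simple_chain_nth)
      then have "t - real i = u - real j"
        using eq True i j by (auto dest!: inj_onD)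
      then show ?thesis using True by simp
    next
      case False
      then have "side (?W ! i) (?W ! Suc i) \<inter> side (?W ! j) (?W ! Suc j) = {}"
        using S ij by (simp add: simple_chain_nth)
      moreover have "linepath (?W ! i) (?W ! Suc i) (t - real i) \<in> side (?W ! i) (?W ! Suc i)"
        "linepath (?W ! j) (?W ! Suc j) (u - real j) \<in> side (?W ! j) (?W ! Suc j)"
        unfolding side_def using i j by auto
      ultimately show ?thesis using eq by auto
    qed
  qed
  show "inj_on (polygon_path P) {0..<real (length P)}"
  proof (rule inj_onI)
    fix t u assume "t \<in> {0..<real (length P)}" "u \<in> {0..<real (length P)}"
      "polygon_path P t = polygon_path P u"
    then show "t = u" using le[of t u] le[of u t] by (cases "t \<le> u") auto
  qed
qed

lemma polygonal_knot_iff: "polygonal_knot P \<longleftrightarrow> P \<noteq> [] \<and> simple_chain (P @ [hd P])"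
  using inj_polygon_path_iff[of P] unfolding polygonal_knot_def curve_eq_polygon_path by blast

lemma range_curve: "P \<noteq> [] \<Longrightarrow> range (curve P) = chain (P @ [hd P])"
  by (simp add: curve_eq_polygon_path range_polygon_path)

lemma simple_chain_rotate1: "simple_chain (rotate1 P @ [hd (rotate1 P)]) \<longleftrightarrow> simple_chain (P @ [hd P])"
proof (cases P)
  case (Cons a xs)
  show ?thesis
  proof (cases xs)
    case (Cons b ys)
    have "(b # ys) @ [a, b] = (b # ys @ [a]) @ [b]" by simp
    then show ?thesis using simple_chain_snoc[of "b # ys" a b] \<open>P = a # xs\<close> Cons by auto
  qed (use Cons in simp)
qed simp

lemma polygonal_knot_rotate1 [simp]: "polygonal_knot (rotate1 P) \<longleftrightarrow> polygonal_knot P"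
  by (simp add: polygonal_knot_iff simple_chain_rotate1)


section \<open>Elementary moves on polygonal knots\<close>

lemma knot_equiv_refl: "knot_equiv P P"
  by (simp add: knot_equiv_def)

lemma knot_equiv_sym: "knot_equiv P Q \<Longrightarrow> knot_equiv Q P"
  unfolding knot_equiv_def by (rule equivclp_sym)

lemma knot_equiv_trans [trans]: "knot_equiv P Q \<Longrightarrow> knot_equiv Q R \<Longrightarrow> knot_equiv P R"
  unfolding knot_equiv_def by (rule equivclp_trans)

lemma knot_equiv_rotate1: "knot_equiv P (rotate1 P)"
  unfolding knot_equiv_def by (rule r_into_equivclp) simp

lemma knot_equiv_triangle_move: "triangle_move P Q \<Longrightarrow> knot_equiv P Q"
  unfolding knot_equiv_def by (rule r_into_equivclp) simp

lemma knot_equiv_append: "knot_equiv (us @ vs) (vs @ us)"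
proof -
  have "knot_equiv P (rotate n P)" for n and P :: "space list"
  proof (induction n)
    case (Suc n)
    then show ?case using knot_equiv_trans[OF Suc knot_equiv_rotate1] by simp
  qed (simp add: knot_equiv_refl)
  from this[of "us @ vs" "length us"] show ?thesis by (simp add: rotate_append)
qed

lemma trivial_knot_cong: "knot_equiv P Q \<Longrightarrow> trivial_knot P \<longleftrightarrow> trivial_knot Q"
  unfolding trivial_knot_def by (meson knot_equiv_sym knot_equiv_trans)

lemma start_in_side [simp]: "a \<in> side a b"
  unfolding side_def by (rule image_eqI[of _ _ 0]) (auto simp: linepath_def)

lemma side_subset_segment: "side a b \<subseteq> closed_segment a b"
  unfolding side_def closed_segment_def linepath_def by fastforce

lemma end_notin_side:
  assumes "a \<noteq> b" shows "b \<notin> side a b"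
proof
  assume "b \<in> side a b"
  then obtain s where s: "s < 1" "b = linepath a b s" by (auto simp: side_def)
  then have "(1 - s) *\<^sub>R (b - a) = 0" by (simp add: linepath_def algebra_simps)
  then show False using s assms by simp
qed

lemma closed_segment_eq_side: "closed_segment a b = insert b (side a b)"
proof
  show "closed_segment a b \<subseteq> insert b (side a b)"
  proof
    fix x assume "x \<in> closed_segment a b"
    then obtain u where u: "0 \<le> u" "u \<le> 1" "x = linepath a b u"
      by (auto simp: closed_segment_def linepath_def)
    show "x \<in> insert b (side a b)"
    proof (cases "u = 1")
      case True
      then show ?thesis using u by (simp add: linepath_def)
    next
      case False
      then have "u \<in> {0..<1}" using u by simp
      then show ?thesis unfolding side_def using u(3) by blast
    qed
  qed
qed (use side_subset_segment in auto)

lemma start_in_chain: "ws \<noteq> [] \<Longrightarrow> a \<in> chain (a # ws)"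
  by (cases ws) auto

lemma segment_subset_range:
  "closed_segment a b \<subseteq> range (curve (a # b # rest))"
  using start_in_chain[of "rest @ [a]" b] by (auto simp: range_curve closed_segment_eq_side)

text \<open>
  Faces of an affinely independent simplex meet in their common face.
\<close>
lemma segments_common_end:
  fixes a b c :: "'a::euclidean_space"
  assumes "\<not> collinear {a, b, c}"
  shows "closed_segment a b \<inter> closed_segment a c = {a}"
proof -
  have "\<not> affine_dependent ({a, b} \<union> {a, c})" "b \<noteq> c"
    using assms by (auto simp: collinear_3_eq_affine_dependent insert_commute)
  then show ?thesis
    using convex_hull_Int[of "{a, b}" "{a, c}"] assms
    by (auto simp: segment_convex_hull)
qed

text \<open>
  For a proper triangle the geometric condition already makes the new polygon a knot: the two new
  sides meet the old side only in its end points, and the rest of the polygon does not pass through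
  the start of that side, being disjoint from the half-open side itself.
\<close>
lemma triangle_moveI:
  assumes P: "polygonal_knot (a # b # rest)" and nc: "\<not> collinear {a, b, c}"
    and hull: "\<And>q. q \<in> convex hull {a, b, c} \<Longrightarrow> q \<in> range (curve (a # b # rest)) \<Longrightarrow> q \<in> closed_segment a b"
  shows "triangle_move (a # b # rest) (a # c # b # rest)"
proof -
  let ?U = "chain (b # rest @ [a])"
  have S: "a \<noteq> b" "side a b \<inter> ?U = {}" "simple_chain (b # rest @ [a])"
    using P by (auto simp: polygonal_knot_iff)
  have R: "range (curve (a # b # rest)) = side a b \<union> ?U"
    by (simp add: range_curve)
  have sub: "closed_segment a b \<subseteq> convex hull {a, b, c}" "closed_segment a c \<subseteq> convex hull {a, b, c}"
    "closed_segment c b \<subseteq> convex hull {a, b, c}"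
    unfolding segment_convex_hull by (rule hull_mono; auto)+
  have dist: "a \<noteq> c" "c \<noteq> b" using nc by (auto simp: insert_commute)
  have meet: "closed_segment a b \<inter> closed_segment a c = {a}"
    "closed_segment b a \<inter> closed_segment b c = {b}"
    "closed_segment c a \<inter> closed_segment c b = {c}"
    using nc by (auto intro!: segments_common_end simp: insert_commute)
  have "side a c \<inter> ?U = {}"
  proof -
    have "side a c \<inter> ?U \<subseteq> closed_segment a b \<inter> closed_segment a c"
      using hull sub side_subset_segment[of a c] R by auto
    also have "\<dots> = {a}" by (rule meet)
    finally have "side a c \<inter> ?U \<subseteq> {a}" .
    moreover have "a \<notin> ?U" using S(2) start_in_side[of a b] by blast
    ultimately show ?thesis by blast
  qed
  moreover have "side c b \<inter> ?U = {}"
  proof -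
    have "side c b \<inter> ?U \<subseteq> closed_segment b a \<inter> closed_segment b c"
      using hull sub side_subset_segment[of c b] R by (auto simp: closed_segment_commute)
    also have "\<dots> = {b}" by (rule meet)
    finally show ?thesis using end_notin_side[OF dist(2)] by blast
  qed
  moreover have "side a c \<inter> side c b = {}"
  proof -
    have "side a c \<inter> side c b \<subseteq> closed_segment c a \<inter> closed_segment c b"
      using side_subset_segment[of c b] side_subset_segment[of a c] by (auto simp: closed_segment_commute)
    then have "side a c \<inter> side c b \<subseteq> {c}" by (simp only: meet(3))
    then show ?thesis using end_notin_side[OF dist(1)] by blast
  qed
  ultimately have Q: "polygonal_knot (a # c # b # rest)"
    using S dist by (auto simp: polygonal_knot_iff)
  have "convex hull {a, b, c} \<inter> range (curve (a # b # rest)) = closed_segment a b"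
    using hull sub segment_subset_range by blast
  with P Q show ?thesis
    unfolding triangle_move_def by blast
qed

lemma range_curve_period: "range (curve P) = curve P ` {0..<real (length P)}" if "P \<noteq> []"
proof
  show "range (curve P) \<subseteq> curve P ` {0..<real (length P)}"
  proof
    fix p assume "p \<in> range (curve P)"
    then obtain t where t: "p = curve P t" by auto
    define k where "k = \<lfloor>t / real (length P)\<rfloor>"
    have n: "real (length P) > 0" using that by simp
    have "curve P (t + of_int (-k) * real (length P)) = p"
      unfolding curve_eq_polygon_path polygon_path_periodic using t by (simp add: curve_eq_polygon_path)
    moreover have "t + of_int (-k) * real (length P) \<in> {0..<real (length P)}"
      using floor_divide_lower[OF n, of t] floor_divide_upper[OF n, of t] by (auto simp: k_def algebra_simps)
    ultimately show "p \<in> curve P ` {0..<real (length P)}" by (metis imageI)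
  qed
qed auto

text \<open>
  The condition depends only on the projected vertices.  The heights of such a knot can therefore be
  changed freely without leaving the class.
\<close>
definition simple_shadow :: "space list \<Rightarrow> bool" where
  "simple_shadow P \<longleftrightarrow> P \<noteq> [] \<and> inj_on (shadow P) {0..<real (length P)}"

lemma simple_shadow_iff:
  "simple_shadow P \<longleftrightarrow> P \<noteq> [] \<and> simple_chain (map fst P @ [hd (map fst P)])"
  using inj_polygon_path_iff[of "map fst P"] by (auto simp: simple_shadow_def shadow_eq_polygon_path)

lemma simple_shadow_cong: "map fst P = map fst Q \<Longrightarrow> simple_shadow P \<longleftrightarrow> simple_shadow Q"
  unfolding simple_shadow_iff by (metis Nil_is_map_conv)

lemma simple_shadow_rotate1 [simp]: "simple_shadow (rotate1 P) \<longleftrightarrow> simple_shadow P"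
  using simple_chain_rotate1[of "map fst P"] by (auto simp: simple_shadow_iff rotate1_map)

lemma simple_shadow_append: "simple_shadow (us @ vs) \<longleftrightarrow> simple_shadow (vs @ us)"
proof -
  have "simple_shadow (rotate n P) = simple_shadow P" for n P
    by (induction n) auto
  then show ?thesis by (metis rotate_append)
qed

lemma simple_shadow_imp_knot: "simple_shadow P \<Longrightarrow> polygonal_knot P"
  unfolding simple_shadow_def polygonal_knot_def shadow_def inj_on_def by metis

lemma simple_shadow_inj: 
  assumes "simple_shadow P" shows "inj_on fst (range (curve P))"
  using assms unfolding simple_shadow_def
  by (auto simp: range_curve_period inj_on_def shadow_def)

lemma simple_shadow_distinct:
  assumes "simple_shadow P" shows "distinct (map fst P)"
proof -
  have P: "P \<noteq> []" "inj_on (shadow P) {0..<real (length P)}" using assms by (auto simp: simple_shadow_def)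
  have v: "shadow P (real i) = map fst P ! i" if "i < length P" for i
    using polygon_path_on_side[of i "map fst P" 0] that
    by (simp add: shadow_eq_polygon_path[OF P(1)] linepath_def nth_append)
  show ?thesis
    unfolding distinct_conv_nth
  proof (intro allI impI)
    fix i j assume ij: "i < length (map fst P)" "j < length (map fst P)" "i \<noteq> j"
    then have "shadow P (real i) \<noteq> shadow P (real j)"
      using inj_onD[OF P(2), of "real i" "real j"] by auto
    then show "map fst P ! i \<noteq> map fst P ! j" using v ij by simp
  qed
qed

text \<open>
  On a period the curve is injective, so the shadow fails to be so exactly at a crossing.
\<close>
lemma simple_shadow_iff_no_crossings: "simple_shadow P \<longleftrightarrow> polygonal_knot P \<and> crossings P = {}"
proof
  assume "simple_shadow P"
  then show "polygonal_knot P \<and> crossings P = {}"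
    using simple_shadow_imp_knot[of P] simple_shadow_inj[of P] by (auto simp: crossings_def inj_on_def)
next
  assume "polygonal_knot P \<and> crossings P = {}"
  then show "simple_shadow P"
    unfolding simple_shadow_def polygonal_knot_def crossings_def inj_on_def shadow_def by blast
qed

text \<open>
  A triangle with a vertical side lies above the shadow of the side \<open>a b\<close>.  Over a simple shadow there is
  only one point of the knot above each point of that segment, so nothing can obstruct the move.
\<close>
lemma insert_vertical:
  assumes P: "simple_shadow (a # b # rest)" and c: "fst c = fst a \<or> fst c = fst b" "c \<noteq> a" "c \<noteq> b"
  shows "triangle_move (a # b # rest) (a # c # b # rest)"
proof (rule triangle_moveI)
  show "polygonal_knot (a # b # rest)" using P by (rule simple_shadow_imp_knot)
  have ab: "fst a \<noteq> fst b" using simple_shadow_distinct[OF P] by simp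
  show "\<not> collinear {a, b, c}"
    using c(1)
  proof
    assume fc: "fst c = fst a"
    show ?thesis
    proof
      assume "collinear {a, b, c}"
      then obtain u where "b = u *\<^sub>R a + (1 - u) *\<^sub>R c" using c by (auto simp: collinear_3_expand)
      then have "fst b = u *\<^sub>R fst a + (1 - u) *\<^sub>R fst a" using fc by simp
      then show False using ab by (simp add: algebra_simps)
    qed
  next
    assume fc: "fst c = fst b"
    show ?thesis
    proof
      assume "collinear {a, b, c}"
      then have "collinear {b, a, c}" by (simp add: insert_commute)
      then obtain u where "a = u *\<^sub>R b + (1 - u) *\<^sub>R c" using c by (auto simp: collinear_3_expand)
      then have "fst a = u *\<^sub>R fst b + (1 - u) *\<^sub>R fst b" using fc by simp
      then show False using ab by (simp add: algebra_simps)
    qed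
  qed
  fix q assume q: "q \<in> convex hull {a, b, c}" "q \<in> range (curve (a # b # rest))"
  have "fst q \<in> fst ` (convex hull {a, b, c})" using q by simp
  also have "\<dots> = convex hull {fst a, fst b}"
    using c(1) by (auto simp: convex_hull_linear_image[OF linear_fst] insert_commute)
  also have "\<dots> = fst ` closed_segment a b"
    by (simp add: segment_convex_hull convex_hull_linear_image[OF linear_fst])
  finally obtain p where p: "p \<in> closed_segment a b" "fst q = fst p" by auto
  then have "q = p"
    using simple_shadow_inj[OF P] q segment_subset_range[of a b rest] by (auto dest!: inj_onD)
  with p show "q \<in> closed_segment a b" by simp
qed

text \<open>
  The vertex \<open>b\<close> is moved by two vertical triangles: \<open>b'\<close> is inserted on the side that ends in \<open>b\<close>, and
  then \<open>b\<close>, now lying between \<open>b'\<close> and its successor, is removed.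
\<close>
lemma move_vertex_vertically:
  assumes P: "simple_shadow (b # rest)" "rest \<noteq> []" and b': "fst b' = fst b"
  shows "knot_equiv (b # rest) (b' # rest)"
proof (cases "b' = b")
  case False
  obtain a us where us: "rest = us @ [a]" using P(2) by (metis rev_exhaust)
  obtain c vs where vs: "rest = c # vs" using P(2) by (cases rest) auto
  have P': "simple_shadow (b' # c # vs)" using P(1) b' by (simp add: vs cong: simple_shadow_cong[of "b' # c # vs" "b # c # vs"])
  have r: "rotate1 (a # b # us) = b # rest" "rotate1 (a # b' # b # us) = b' # b # rest"
    using us by auto
  have P1: "simple_shadow (a # b # us)"
    using P(1) by (simp only: r(1)[symmetric] simple_shadow_rotate1)
  have "fst a \<noteq> fst b" using simple_shadow_distinct[OF P1] by auto
  have t1: "triangle_move (a # b # us) (a # b' # b # us)"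
    using \<open>fst a \<noteq> fst b\<close> b' False by (intro insert_vertical P1) auto
  have "fst c \<noteq> fst b" using simple_shadow_distinct[OF P(1)] vs by auto
  have t2: "triangle_move (b' # c # vs) (b' # b # c # vs)"
    using \<open>fst c \<noteq> fst b\<close> b' False by (intro insert_vertical P') auto
  \<comment> \<open>Moves apply to the first side of a list only, so the polygon is rotated between them.\<close>
  have "knot_equiv (b # rest) (a # b # us)"
    using knot_equiv_rotate1[of "a # b # us"] unfolding r by (rule knot_equiv_sym)
  also have "knot_equiv \<dots> (a # b' # b # us)" using t1 by (rule knot_equiv_triangle_move)
  also have "knot_equiv \<dots> (b' # b # rest)"
    using knot_equiv_rotate1[of "a # b' # b # us"] unfolding r .
  also have "knot_equiv \<dots> (b' # rest)"
    using t2 unfolding vs by (rule knot_equiv_sym[OF knot_equiv_triangle_move])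
  finally show ?thesis .
qed (simp add: knot_equiv_refl)

lemma knot_equiv_same_shadow:
  assumes "simple_shadow P" "2 \<le> length P" "map fst Q = map fst P"
  shows "knot_equiv P Q"
proof -
  have "length xs = length ys \<Longrightarrow> simple_shadow (us @ xs) \<Longrightarrow> 2 \<le> length (us @ xs) \<Longrightarrow>
     map fst ys = map fst xs \<Longrightarrow> knot_equiv (us @ xs) (us @ ys)" for us xs ys :: "space list"
  proof (induction xs ys arbitrary: us rule: list_induct2)
    case (Cons x xs y ys)
    have s: "simple_shadow (x # xs @ us)"
      using Cons.prems(1) simple_shadow_append[of us "x # xs"] by simp
    have "knot_equiv (us @ x # xs) (x # xs @ us)"
      using knot_equiv_append[of us "x # xs"] by simp
    also have "knot_equiv \<dots> (y # xs @ us)"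
      using Cons.prems by (intro move_vertex_vertically s) auto
    also have "knot_equiv \<dots> (us @ y # xs)"
      using knot_equiv_append[of "y # xs" us] by simp
    also have "knot_equiv \<dots> (us @ y # ys)"
    proof -
      have "simple_shadow ((us @ [y]) @ xs)"
        using Cons.prems(1,3) simple_shadow_cong[of "us @ y # xs" "us @ x # xs"] by simp
      then show ?thesis using Cons.IH[of "us @ [y]"] Cons.prems by simp
    qed
    finally show ?case .
  qed (simp add: knot_equiv_refl)
  from this[of P Q "[]"] show ?thesis using assms map_eq_imp_length_eq[OF assms(3)] by simp
qed


section \<open>Diagrams without crossings present the trivial knot\<close>

text \<open>
  Consecutive sides occupy consecutive height intervals.
\<close>
lemma rising_chain:
  fixes ws :: "space list"
  assumes "sorted_wrt (\<lambda>p q. snd p < snd q) ws"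
  shows "simple_chain ws \<and> (\<forall>p\<in>chain ws. snd (hd ws) \<le> snd p)"
  using assms
proof (induction ws rule: induct_list012)
  case (3 a b ws)
  have ab: "snd a < snd b" using 3 by simp
  have low: "snd a \<le> snd p \<and> snd p < snd b" if p: "p \<in> side a b" for p
  proof -
    obtain s where s: "0 \<le> s" "s < 1" "p = linepath a b s" using p by (auto simp: side_def)
    then have "snd p = snd a + s * (snd b - snd a)"
      by (simp add: linepath_def left_diff_distrib right_diff_distrib)
    moreover have "0 \<le> s * (snd b - snd a)" "s * (snd b - snd a) < 1 * (snd b - snd a)"
      using s ab by (auto intro: mult_strict_right_mono)
    ultimately show ?thesis by simp
  qed
  have IH: "simple_chain (b # ws)" "\<And>p. p \<in> chain (b # ws) \<Longrightarrow> snd b \<le> snd p"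
    using 3 by auto
  then show ?case using low ab by (fastforce dest: order.trans)
qed auto

lemma side_avoids_fibre:
  assumes H: "convex H" "z \<notin> H" and a: "fst a \<in> H" and b: "fst b \<in> H \<or> fst b = z"
    and p: "p \<in> side a b"
  shows "fst p \<noteq> z"
proof
  assume pz: "fst p = z"
  obtain s where s: "0 \<le> s" "s < 1" "p = linepath a b s" using p by (auto simp: side_def)
  then have e: "fst p = (1 - s) *\<^sub>R fst a + s *\<^sub>R fst b" by (simp add: linepath_def)
  from b show False
  proof
    assume "fst b \<in> H"
    then have "fst p \<in> H" unfolding e using H a s by (intro convexD) auto
    then show False using pz H by simp
  next
    assume "fst b = z"
    then have "(1 - s) *\<^sub>R (fst a - z) = fst p - z" using e by (simp add: scaleR_diff_right scaleR_left_diff_distrib)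
    then have "(1 - s) *\<^sub>R (fst a - z) = 0" using pz by simp
    then show False using s a H by auto
  qed
qed

lemma chain_avoids_fibre:
  assumes "convex H" "z \<notin> H" "fst ` set ws \<subseteq> H" "fst c = z" "p \<in> chain (ws @ [c])"
  shows "fst p \<noteq> z"
  using assms(3,5)
proof (induction ws rule: induct_list012)
  case (2 a)
  then show ?case using side_avoids_fibre[OF assms(1,2), of a c] assms(4) by simp
next
  case (3 a b ws)
  have "p \<in> side a b \<or> p \<in> chain ((b # ws) @ [c])" using 3 by simp
  moreover have "fst a \<in> H" "fst b \<in> H" "fst ` set (b # ws) \<subseteq> H" using 3 by auto
  ultimately show ?case using side_avoids_fibre[OF assms(1,2), of a b p] 3 by blast
qed simp

text \<open>
  The closed polygon \<open>a # xs @ [c]\<close> rises from \<open>a\<close> to \<open>c\<close> and returns along a vertical side.  The convex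
  set \<open>H\<close> keeps the shadows of the vertices in between away from that side; having it
  as a parameter, rather than taking the convex hull of the shadow of \<open>xs\<close>, lets vertices be removed from \<open>xs\<close>
  without changing it.
\<close>
definition tower :: "complex set \<Rightarrow> space list \<Rightarrow> space \<Rightarrow> space \<Rightarrow> bool" where
  "tower H xs a c \<longleftrightarrow> convex H \<and> fst ` set xs \<subseteq> H \<and> fst a \<notin> H \<and> fst c = fst a \<and>
     sorted_wrt (\<lambda>p q. snd p < snd q) (a # xs @ [c]) \<and> xs \<noteq> []"

lemma vertical_side: 
  assumes "fst c = fst a" "p \<in> side c a" shows "fst p = fst a"
  using assms by (auto simp: side_def linepath_def algebra_simps)

lemma tower_knot:
  assumes T: "tower H xs a c"
  shows "polygonal_knot (a # xs @ [c])"
proof -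
  obtain x ys where xs: "xs = x # ys" using T by (cases xs) (auto simp: tower_def)
  have T': "convex H" "fst ` set xs \<subseteq> H" "fst a \<notin> H" "fst c = fst a"
    "sorted_wrt (\<lambda>p q. snd p < snd q) (a # xs @ [c])"
    using T by (auto simp: tower_def)
  have ca: "c \<noteq> a" using T' by auto
  have S: "simple_chain (a # xs @ [c])" using rising_chain[OF T'(5)] by simp
  have "side c a \<inter> chain (a # xs @ [c]) = {}"
  proof -
    have "p \<notin> chain (a # xs @ [c])" if p: "p \<in> side c a" for p
    proof
      assume pc: "p \<in> chain (a # xs @ [c])"
      have pz: "fst p = fst a" using vertical_side[OF T'(4) p] .
      then have "p \<notin> chain (xs @ [c])"
        using chain_avoids_fibre[OF T'(1,3,2,4)] by blast
      then have "p \<in> side a x" using pc xs by simp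
      then obtain s where s: "p = linepath a x s" by (auto simp: side_def)
      then have "s *\<^sub>R (fst x - fst a) = fst p - fst a"
        by (simp add: linepath_def scaleR_diff_right scaleR_left_diff_distrib)
      then have "s *\<^sub>R (fst x - fst a) = 0" using pz by simp
      moreover have "fst x \<noteq> fst a" using T' xs by auto
      ultimately have "p = a" using s by (simp add: linepath_def)
      then show False using p end_notin_side[OF ca] by simp
    qed
    then show ?thesis by blast
  qed
  then have "polygonal_knot (c # a # xs)"
    using S ca by (simp add: polygonal_knot_iff)
  then show ?thesis
    using polygonal_knot_rotate1[of "c # a # xs"] by simp
qed

text \<open>
  The vertex after \<open>a\<close> can be cut off as long as another one follows.  The triangle of \<open>a\<close> and the next two
  vertices \<open>x\<close>, \<open>y\<close> meets the polygon beyond \<open>y\<close> only in \<open>y\<close>, because that part lies higher, and it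
  meets the vertical side only in \<open>a\<close>, because \<open>x\<close> and \<open>y\<close> project into \<open>H\<close>.  Here \<open>x\<close> may lie on the side
  \<open>a y\<close>; this is why the move is checked from its definition, both polygons being towers and
  hence knots.
\<close>
lemma tower_trivial:
  assumes "tower H xs a c"
  shows "trivial_knot (a # xs @ [c])"
  using assms
proof (induction xs)
  case Nil
  then show ?case by (simp add: tower_def)
next
  case (Cons x xs)
  show ?case
  proof (cases xs)
    case Nil
    then show ?thesis
      unfolding trivial_knot_def using tower_knot[OF Cons.prems] knot_equiv_refl by fastforce
  next
    case (Cons y ys)
    have T: "convex H" "fst x \<in> H" "fst y \<in> H" "fst a \<notin> H" "fst c = fst a"
      "sorted_wrt (\<lambda>p q. snd p < snd q) (y # ys @ [c])"
      "snd a < snd y" "snd x < snd y" "fst ` set (y # ys) \<subseteq> H"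
      using Cons.prems Cons by (auto simp: tower_def)
    have T1: "tower H xs a c" using Cons.prems Cons by (auto simp: tower_def)
    have P: "polygonal_knot (a # y # ys @ [c])" using tower_knot[OF T1] Cons by simp
    have Q: "polygonal_knot (a # x # y # ys @ [c])" using tower_knot[OF Cons.prems] Cons by simp
    have R: "range (curve (a # y # ys @ [c])) = side a y \<union> chain (y # ys @ [c]) \<union> side c a"
      using chain_snoc[of "a # y # ys" c a] by (simp add: range_curve Un_assoc)
    have "q \<in> closed_segment a y"
      if q: "q \<in> convex hull {a, y, x}" "q \<in> range (curve (a # y # ys @ [c]))" for q
    proof -
      obtain u v w where uvw: "0 \<le> u" "0 \<le> v" "0 \<le> w" "u + v + w = 1"
        "q = u *\<^sub>R a + v *\<^sub>R y + w *\<^sub>R x"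
        using q(1) by (auto simp: convex_hull_3)
      consider "q \<in> side a y" | "q \<in> chain (y # ys @ [c])" | "q \<in> side c a"
        using q(2) R by blast
      then show ?thesis
      proof cases
        case 1
        then show ?thesis using side_subset_segment by blast
      next
        case 2
        then have "snd y \<le> snd q" using rising_chain[OF T(6)] by simp
        have "v = 1 - u - w" using uvw by simp
        then have "snd q = snd y - u * (snd y - snd a) - w * (snd y - snd x)"
          using uvw(5) by (simp add: left_diff_distrib right_diff_distrib)
        moreover have "0 \<le> u * (snd y - snd a)" "0 \<le> w * (snd y - snd x)" using uvw T by auto
        ultimately have "u * (snd y - snd a) = 0" "w * (snd y - snd x) = 0"
          using \<open>snd y \<le> snd q\<close> by linarith+
        then have "u = 0" "w = 0" using T by auto
        then show ?thesis using uvw by simp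
      next
        case 3
        then have qz: "fst q = fst a" using vertical_side T(5) by blast
        have "u = 1"
        proof (rule ccontr)
          assume "u \<noteq> 1"
          define r where "r = v + w"
          have r: "r > 0" "u = 1 - r" using \<open>u \<noteq> 1\<close> uvw by (auto simp: r_def)
          have "r *\<^sub>R fst a = v *\<^sub>R fst y + w *\<^sub>R fst x"
            using qz uvw(5) r(2) by (simp add: algebra_simps)
          then have "(1 / r) *\<^sub>R (r *\<^sub>R fst a) = (1 / r) *\<^sub>R (v *\<^sub>R fst y + w *\<^sub>R fst x)"
            by simp
          then have "fst a = (v / r) *\<^sub>R fst y + (w / r) *\<^sub>R fst x"
            using r by (simp add: scaleR_add_right)
          moreover have "(v / r) *\<^sub>R fst y + (w / r) *\<^sub>R fst x \<in> H"
            using T uvw r by (intro convexD[OF T(1)]) (auto simp: r_def add_divide_distrib[symmetric])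
          ultimately show False using T(4) by simp
        qed
        then have "v = 0" "w = 0" using uvw by auto
        then show ?thesis using uvw by simp
      qed
    qed
    then have "convex hull {a, y, x} \<inter> range (curve (a # y # ys @ [c])) = closed_segment a y"
      using segment_subset_range[of a y "ys @ [c]"] hull_mono[of "{a, y}" "{a, y, x}" convex]
      unfolding segment_convex_hull[of a y] by blast
    then have "triangle_move (a # y # ys @ [c]) (a # x # y # ys @ [c])"
      using P Q unfolding triangle_move_def by blast
    then show ?thesis
      using Cons.IH[OF T1] trivial_knot_cong[OF knot_equiv_triangle_move] Cons by simp
  qed
qed

text \<open>
  An extreme point of the convex hull is a vertex, and the hull without it is still convex.
\<close>
lemma exposed_vertex:
  assumes "distinct zs" "zs \<noteq> []"
  obtains us z vs where "zs = us @ z # vs" "(z::complex) \<notin> convex hull (set (vs @ us))"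
proof -
  have "compact (convex hull (set zs))" by (simp add: finite_imp_compact_convex_hull)
  then obtain z where z: "z extreme_point_of (convex hull (set zs))"
    using extreme_point_exists_convex[of "convex hull (set zs)"] assms(2) by auto
  then have "z \<in> set zs" by (rule extreme_point_of_convex_hull)
  then obtain us vs where uv: "zs = us @ z # vs" by (meson split_list)
  have "set (vs @ us) \<subseteq> convex hull (set zs) - {z}"
    using hull_subset[of "set zs" convex] assms(1) uv by auto
  moreover have "convex (convex hull (set zs) - {z})"
    using z extreme_point_of_stillconvex by blast
  ultimately have "convex hull (set (vs @ us)) \<subseteq> convex hull (set zs) - {z}"
    by (rule hull_minimal)
  then show ?thesis using that uv by blast
qed

text \<open>
  Vertical moves turn a knot with simple shadow into a tower: starting at a vertex whose shadow is
  an extreme point, the vertices get the heights \<open>0, 1, 2, \<dots>\<close>, and a last vertex \<open>c\<close> is inserted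
  above the first one.
\<close>
lemma simple_shadow_trivial:
  assumes S: "simple_shadow P"
  shows "trivial_knot P"
proof -
  have "P \<noteq> []" using S by (simp add: simple_shadow_def)
  then obtain us0 z vs0 where e: "map fst P = us0 @ z # vs0" "z \<notin> convex hull (set (vs0 @ us0))"
    using exposed_vertex[of "map fst P"] simple_shadow_distinct[OF S] by auto
  then obtain us x vs where P: "P = us @ x # vs" "map fst us = us0" "fst x = z" "map fst vs = vs0"
    by (auto simp: map_eq_append_conv map_eq_Cons_conv)
  define xs where "xs = vs @ us"
  define n where "n = length (x # xs)"
  have S1: "simple_shadow (x # xs)"
    using S simple_shadow_append[of us "x # vs"] by (simp add: P xs_def)
  have "xs \<noteq> []" using S1 by (auto simp: simple_shadow_iff)
  define Q where "Q = zip (map fst (x # xs)) (map real [0..<n])"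
  have Q1: "map fst Q = map fst (x # xs)" by (simp add: Q_def n_def)
  have lQ: "length Q = n" by (simp add: Q_def n_def)
  have Q2: "snd (Q ! i) = real i" if "i < n" for i using that by (simp add: Q_def n_def del: upt_Suc)
  define c where "c = (z, real n)"
  obtain a ys where Q: "Q = a # ys" "ys \<noteq> []"
    using lQ \<open>xs \<noteq> []\<close> unfolding n_def by (cases Q; cases "tl Q") auto
  obtain ws l where ys: "ys = ws @ [l]" using Q(2) by (metis rev_exhaust)
  have az: "fst a = z" and fys: "map fst ys = map fst xs" using Q1 Q P by auto
  have "sorted_wrt (\<lambda>p q. snd p < snd q) (Q @ [c])"
    unfolding sorted_wrt_iff_nth_less using Q2 lQ by (auto simp: nth_append c_def less_Suc_eq)
  moreover have "fst ` set ys = set (vs0 @ us0)"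
    using fys by (metis P(2,4) list.set_map map_append xs_def)
  ultimately have T: "tower (convex hull (fst ` set ys)) ys a c"
    using e(2) Q az by (auto simp: tower_def c_def hull_subset)
  have SQ: "simple_shadow (a # ys)" using S1 simple_shadow_cong[OF Q1] Q by simp
  have S2: "simple_shadow (l # a # ws)"
    using SQ simple_shadow_append[of "[l]" "a # ws"] ys by simp
  have ac: "fst c = fst a" "snd a \<noteq> snd c" using T by (auto simp: tower_def)
  moreover have "fst l \<noteq> fst a" using simple_shadow_distinct[OF S2] by auto
  ultimately have tm: "triangle_move (l # a # ws) (l # c # a # ws)"
    using S2 by (intro insert_vertical) auto
  have "knot_equiv P (x # xs)"
    using knot_equiv_append[of us "x # vs"] by (simp add: P xs_def)
  also have "knot_equiv \<dots> (a # ys)"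
    using S1 Q1 \<open>xs \<noteq> []\<close> Q by (intro knot_equiv_same_shadow) (cases xs; auto)+
  also have "knot_equiv \<dots> (l # a # ws)"
    using knot_equiv_append[of "a # ws" "[l]"] ys by simp
  also have "knot_equiv \<dots> (l # c # a # ws)" using tm by (rule knot_equiv_triangle_move)
  also have "knot_equiv \<dots> (a # ys @ [c])"
    using knot_equiv_trans[OF knot_equiv_rotate1 knot_equiv_rotate1, of "l # c # a # ws"] ys by simp
  finally show ?thesis using trivial_knot_cong tower_trivial[OF T] by blast
qed


section \<open>Triangles have diagrams without crossings\<close>

lemma simple_triangle_iff:
  fixes a b c :: "'a::euclidean_space"
  shows "simple_chain [a, b, c, a] \<longleftrightarrow> \<not> collinear {a, b, c}"
proof
  assume S: "simple_chain [a, b, c, a]"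
  show "\<not> collinear {a, b, c}"
  proof
    assume "collinear {a, b, c}"
    then consider "a \<in> closed_segment b c" | "b \<in> closed_segment c a" | "c \<in> closed_segment a b"
      unfolding collinear_between_cases between_mem_segment by auto
    then show False
    proof cases
      case 1
      then have "a \<in> side b c" using S by (auto simp: closed_segment_eq_side)
      moreover have "a \<in> side a b" by simp
      ultimately show False using S unfolding simple_chain_simps chain_simps by blast
    next
      case 2
      then have "b \<in> side c a" using S by (auto simp: closed_segment_eq_side)
      moreover have "b \<in> side b c" by simp
      ultimately show False using S unfolding simple_chain_simps chain_simps by blast
    next
      case 3
      then have "c \<in> side a b" using S by (auto simp: closed_segment_eq_side)
      moreover have "c \<in> side c a" by simp
      ultimately show False using S unfolding simple_chain_simps chain_simps by blast
    qed
  qed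
next
  assume nc: "\<not> collinear {a, b, c}"
  then have d: "a \<noteq> b" "b \<noteq> c" "c \<noteq> a" by (auto simp: insert_commute)
  have meet: "closed_segment a b \<inter> closed_segment a c = {a}"
    "closed_segment b a \<inter> closed_segment b c = {b}"
    "closed_segment c a \<inter> closed_segment c b = {c}"
    using nc by (auto intro!: segments_common_end simp: insert_commute)
  have "side a b \<inter> side b c = {}"
  proof -
    have "side a b \<inter> side b c \<subseteq> {b}"
      using meet(2) side_subset_segment[of a b] side_subset_segment[of b c] by (auto simp: closed_segment_commute)
    then show ?thesis using end_notin_side[OF d(1)] by blast
  qed
  moreover have "side b c \<inter> side c a = {}"
  proof -
    have "side b c \<inter> side c a \<subseteq> {c}"
      using meet(3) side_subset_segment[of b c] side_subset_segment[of c a] by (auto simp: closed_segment_commute)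
    then show ?thesis using end_notin_side[OF d(2)] by blast
  qed
  moreover have "side a b \<inter> side c a = {}"
  proof -
    have "side a b \<inter> side c a \<subseteq> {a}"
      using meet(1) side_subset_segment[of a b] side_subset_segment[of c a] by (auto simp: closed_segment_commute)
    then show ?thesis using end_notin_side[OF d(3)] by blast
  qed
  ultimately show "simple_chain [a, b, c, a]" using d by (auto simp: Int_Un_distrib)
qed

lemma triangle_knot_iff: "polygonal_knot [a, b, c] \<longleftrightarrow> \<not> collinear {a, b, c}"
  using simple_triangle_iff[of a b c] by (simp add: polygonal_knot_iff)

lemma triangle_simple_shadow_iff: "simple_shadow [a, b, c] \<longleftrightarrow> \<not> collinear {fst a, fst b, fst c}"
  using simple_triangle_iff[of "fst a" "fst b" "fst c"] by (simp add: simple_shadow_iff)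

text \<open>
  Two faces of a tetrahedron meet in their common edge only.
\<close>
lemma tetrahedron_move:
  assumes ind: "\<not> affine_dependent {a, b, c, d}" and dist: "distinct [a, b, c, d]"
  shows "triangle_move [a, b, c] [a, d, b, c]"
proof (rule triangle_moveI)
  have nd: "\<not> affine_dependent S" if "S \<subseteq> {a, b, c, d}" for S
    using ind affine_dependent_subset that by blast
  show "polygonal_knot [a, b, c]"
    using nd[of "{a, b, c}"] dist unfolding triangle_knot_iff collinear_3_eq_affine_dependent by auto
  show "\<not> collinear {a, b, d}"
    using nd[of "{a, b, d}"] dist unfolding collinear_3_eq_affine_dependent by auto
  fix q assume q: "q \<in> convex hull {a, b, d}" "q \<in> range (curve [a, b, c])"
  have "q \<in> closed_segment a b \<union> closed_segment b c \<union> closed_segment c a"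
    using q(2) side_subset_segment[of a b] side_subset_segment[of b c] side_subset_segment[of c a]
    by (auto simp: range_curve)
  moreover have I: "{a, b, d} \<inter> {b, c} = {b}" "{a, b, d} \<inter> {c, a} = {a}"
    using dist by auto
  moreover have "convex hull {a, b, d} \<inter> convex hull {b, c} = {b}"
    using convex_hull_Int[of "{a, b, d}" "{b, c}"] nd[of "{a, b, d} \<union> {b, c}"] unfolding I by simp
  moreover have "convex hull {a, b, d} \<inter> convex hull {c, a} = {a}"
    using convex_hull_Int[of "{a, b, d}" "{c, a}"] nd[of "{a, b, d} \<union> {c, a}"] unfolding I by simp
  ultimately show "q \<in> closed_segment a b"
    using q(1) unfolding segment_convex_hull[of b c] segment_convex_hull[of c a] by auto
qed

text \<open>
  A triangle in a vertical plane is replaced by one with the vertex \<open>b\<close> pulled out of that plane to \<open>d\<close>.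
  Inserting \<open>d\<close> and then removing \<open>b\<close> are moves across two faces of the tetrahedron
  \<open>a b c d\<close>.
\<close>
lemma tilt_triangle:
  assumes nc: "\<not> collinear {a, b, c}" and flat: "collinear {fst a, fst b, fst c}" and ac: "fst a \<noteq> fst c"
  shows "\<exists>D. simple_shadow D \<and> knot_equiv D [a, b, c :: space]"
proof -
  \<comment> \<open>Multiplication by \<open>\<i>\<close> is a quarter turn, so \<open>w\<close> is off the line that contains the projection of the triangle.\<close>
  define w where "w = fst a + \<i> * (fst c - fst a)"
  define d where "d = (w, 0 :: real)"
  have w: "\<not> collinear {fst a, w, fst c}"
  proof
    assume "collinear {fst a, w, fst c}"
    then obtain u where "w = u *\<^sub>R fst a + (1 - u) *\<^sub>R fst c" using ac by (auto simp: collinear_3_expand)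
    then have "w - fst a = (1 - u) *\<^sub>R (fst c - fst a)" by (simp add: algebra_simps)
    then have "\<i> * (fst c - fst a) = of_real (1 - u) * (fst c - fst a)"
      by (simp add: w_def scaleR_conv_of_real)
    then have "\<i> = of_real (1 - u)" using ac by simp
    then show False by (simp add: complex_eq_iff)
  qed
  have d: "d \<notin> affine hull {a, b, c}"
  proof
    assume "d \<in> affine hull {a, b, c}"
    then obtain x y z where xyz: "x + y + z = 1" "d = x *\<^sub>R a + y *\<^sub>R b + z *\<^sub>R c"
      by (auto simp: affine_hull_3)
    obtain u where u: "fst b = u *\<^sub>R fst a + (1 - u) *\<^sub>R fst c"
      using flat ac by (auto simp: collinear_3_expand)
    have "w = x *\<^sub>R fst a + y *\<^sub>R fst b + z *\<^sub>R fst c" using xyz(2) by (simp add: d_def prod_eq_iff)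
    also have "\<dots> = (x + y * u) *\<^sub>R fst a + (y * (1 - u) + z) *\<^sub>R fst c"
      unfolding u by (simp add: algebra_simps)
    also have "y * (1 - u) + z = 1 - (x + y * u)" using xyz(1) by (simp add: algebra_simps)
    finally show False using w unfolding collinear_3_expand by blast
  qed
  then have dist: "distinct [a, b, c, d]"
    using nc hull_subset[of "{a, b, c}" affine] by (auto simp: insert_commute)
  have "\<not> affine_dependent {a, b, c}" using nc by (auto simp: collinear_3_eq_affine_dependent)
  then have ind: "\<not> affine_dependent (insert d {a, b, c})" using d by (rule affine_independent_insert)
  have "knot_equiv [a, b, c] [a, d, b, c]"
    using ind dist by (intro knot_equiv_triangle_move tetrahedron_move) (auto simp: insert_commute)
  also have "knot_equiv \<dots> [d, b, c, a]"
    using knot_equiv_rotate1[of "[a, d, b, c]"] by simp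
  also have "knot_equiv \<dots> [d, c, a]"
    using ind dist by (intro knot_equiv_sym[OF knot_equiv_triangle_move] tetrahedron_move)
      (auto simp: insert_commute)
  finally have "knot_equiv [d, c, a] [a, b, c]" by (rule knot_equiv_sym)
  moreover have "simple_shadow [d, c, a]"
    using w by (simp add: triangle_simple_shadow_iff d_def insert_commute)
  ultimately show ?thesis by blast
qed

lemma triangle_has_simple_shadow:
  assumes nc: "\<not> collinear {a, b, c}"
  shows "\<exists>D. simple_shadow D \<and> knot_equiv D [a, b, c]"
proof (cases "collinear {fst a, fst b, fst c}")
  case True
  have rot: "\<not> collinear {b, c, a}" "collinear {fst b, fst c, fst a}"
    using nc True by (simp_all add: insert_commute)
  have eq: "knot_equiv [b, c, a] [a, b, c]"
    using knot_equiv_append[of "[b, c]" "[a]"] by simp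
  show ?thesis
  proof (cases "fst a = fst c")
    case ac: True
    have "fst b \<noteq> fst a"
    proof
      assume ba: "fst b = fst a"
      have "\<exists>k. x - y = k *\<^sub>R (0, 1)" if "x \<in> {a, b, c}" "y \<in> {a, b, c}" for x y
        using that ac ba by (intro exI[of _ "snd x - snd y"]) (auto simp: prod_eq_iff)
      then have "collinear {a, b, c}" unfolding collinear_def by blast
      then show False using nc by simp
    qed
    then show ?thesis using tilt_triangle[OF rot] eq knot_equiv_trans by blast
  qed (use tilt_triangle[OF nc True] in blast)
qed (use triangle_simple_shadow_iff knot_equiv_refl in blast)

text \<open>
  Of the equivalence of knots, only this enters the computation of spans.
\<close>
lemma trivial_knot_iff_crossingless_diagram:
  "trivial_knot K \<longleftrightarrow> (\<exists>D. diagram_of D K \<and> crossings D = {})"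
proof
  assume "trivial_knot K"
  then obtain a b c where abc: "polygonal_knot [a, b, c]" "knot_equiv K [a, b, c]"
    by (auto simp: trivial_knot_def)
  then obtain D where "simple_shadow D" "knot_equiv D [a, b, c]"
    using triangle_has_simple_shadow triangle_knot_iff by blast
  then show "\<exists>D. diagram_of D K \<and> crossings D = {}"
    using abc(2) knot_equiv_sym knot_equiv_trans
    unfolding simple_shadow_iff_no_crossings diagram_of_def knot_diagram_def
    by (metis empty_iff finite.emptyI)
next
  assume "\<exists>D. diagram_of D K \<and> crossings D = {}"
  then obtain D where "simple_shadow D" "knot_equiv D K"
    unfolding simple_shadow_iff_no_crossings diagram_of_def knot_diagram_def by blast
  then show "trivial_knot K"
    using simple_shadow_trivial trivial_knot_cong by blast
qed


section \<open>Warping degrees along a diagram\<close>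

lemma curve_periodic: "curve D (t + of_int k * real (length D)) = curve D t"
  by (simp add: curve_eq_polygon_path polygon_path_periodic)

lemma shadow_periodic: "shadow D (t + of_int k * real (length D)) = shadow D t"
  by (simp add: shadow_def curve_periodic)

lemma under_at_periodic: "under_at D (t + of_int k * real (length D)) = under_at D t"
  by (simp add: under_at_def curve_periodic shadow_periodic)

lemma curve_eq_iff:
  assumes "polygonal_knot D"
  shows "curve D s = curve D t \<longleftrightarrow> (\<exists>k::int. t = s + of_int k * real (length D))"
proof
  define n where "n = real (length D)"
  have n: "n > 0" using assms by (simp add: n_def polygonal_knot_def)
  assume eq: "curve D s = curve D t"
  define r where "r x = x + of_int (- \<lfloor>x / n\<rfloor>) * n" for x
  have r: "r x \<in> {0..<n}" "curve D (r x) = curve D x" for x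
    using floor_divide_lower[OF n, of x] floor_divide_upper[OF n, of x] curve_periodic[of D x "- \<lfloor>x / n\<rfloor>"]
    by (auto simp: r_def algebra_simps n_def)
  have "r s = r t"
    using assms eq r inj_onD[of "curve D" "{0..<n}" "r s" "r t"]
    unfolding polygonal_knot_def n_def[symmetric] by simp
  then have "t = s + of_int (\<lfloor>t / n\<rfloor> - \<lfloor>s / n\<rfloor>) * n" by (simp add: r_def algebra_simps)
  then show "\<exists>k::int. t = s + of_int k * real (length D)" unfolding n_def by blast
qed (auto simp: curve_periodic)

definition crossing_times :: "space list \<Rightarrow> real set" where
  "crossing_times D = {t. shadow D t \<in> crossings D}"

text \<open>
  The start \<open>x\<close> itself does not count as a visit.  If \<open>x\<close> is a crossing time, this amounts to a base
  point immediately after \<open>x\<close>.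
\<close>
definition first_visit :: "space list \<Rightarrow> real \<Rightarrow> complex \<Rightarrow> real \<Rightarrow> bool" where
  "first_visit D x c t \<longleftrightarrow> x < t \<and> shadow D t = c \<and> (\<forall>r\<in>{x<..<t}. shadow D r \<noteq> c)"

definition warping_after :: "space list \<Rightarrow> real \<Rightarrow> complex set" where
  "warping_after D x = {c \<in> crossings D. \<exists>t. first_visit D x c t \<and> under_at D t}"

lemma first_visit_unique: "first_visit D x c s \<Longrightarrow> first_visit D x c t \<Longrightarrow> s = t"
  unfolding first_visit_def by (metis greaterThanLessThan_iff linorder_neqE)

lemma consecutive_crossings_iff:
  "consecutive_crossings D s t \<longleftrightarrow>
     s < t \<and> s \<in> crossing_times D \<and> t \<in> crossing_times D \<and> crossing_times D \<inter> {s<..<t} = {}"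
  by (auto simp: consecutive_crossings_def crossing_times_def)

context
  fixes D :: "space list"
  assumes D: "knot_diagram D"
begin

lemma knot: "polygonal_knot D"
  using D by (simp add: knot_diagram_def)

lemma period_pos: "0 < real (length D)"
  using knot by (simp add: polygonal_knot_def)

lemma crossing_times_periodic [simp]:
  "t + of_int k * real (length D) \<in> crossing_times D \<longleftrightarrow> t \<in> crossing_times D"
  by (simp add: crossing_times_def shadow_periodic)

lemma crossing_times_shift [simp]:
  "t + real (length D) \<in> crossing_times D \<longleftrightarrow> t \<in> crossing_times D"
  "t - real (length D) \<in> crossing_times D \<longleftrightarrow> t \<in> crossing_times D"
  using crossing_times_periodic[of t 1] crossing_times_periodic[of t "-1"] by simp_all

lemma crossing_strands:
  assumes s: "s \<in> crossing_times D"
  obtains q where "q \<in> range (curve D)" "q \<noteq> curve D s" "fst q = shadow D s"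
    "{p \<in> range (curve D). fst p = shadow D s} = {curve D s, q}"
proof -
  have "card {p \<in> range (curve D). fst p = shadow D s} = 2"
    using s D by (auto simp: crossing_times_def knot_diagram_def)
  then obtain p q where pq: "{p \<in> range (curve D). fst p = shadow D s} = {p, q}" "p \<noteq> q"
    by (auto simp: card_2_iff)
  moreover have "curve D s \<in> {p \<in> range (curve D). fst p = shadow D s}"
    by (simp add: shadow_def)
  ultimately show ?thesis
    using that[of p] that[of q] by (auto simp: insert_commute)
qed

text \<open>
  Exactly two points of the knot lie above a crossing, and their heights differ.
\<close>
lemma under_at_other_strand:
  assumes "s \<in> crossing_times D" "shadow D t = shadow D s" "curve D t \<noteq> curve D s"
  shows "under_at D t \<longleftrightarrow> \<not> under_at D s"
proof -
  obtain q where q: "{p \<in> range (curve D). fst p = shadow D s} = {curve D s, q}"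
    using crossing_strands[OF assms(1)] by metis
  have "curve D t \<in> {p \<in> range (curve D). fst p = shadow D s}"
    using assms(2) by (simp add: shadow_def)
  then have "q = curve D t" using q assms(3) by auto
  then have F: "p \<in> range (curve D) \<and> fst p = shadow D s \<longleftrightarrow> p = curve D s \<or> p = curve D t" for p
    using q by blast
  have "snd (curve D s) \<noteq> snd (curve D t)"
    using assms(2,3) by (auto simp: shadow_def prod_eq_iff)
  then show ?thesis
    unfolding under_at_def assms(2) using F
    by (metis less_irrefl linorder_less_linear not_less_iff_gr_or_eq)
qed

lemma second_visit:
  assumes s: "s \<in> crossing_times D"
  obtains t where "s < t" "t < s + real (length D)" "shadow D t = shadow D s"
proof -
  obtain q where q: "q \<in> range (curve D)" "q \<noteq> curve D s" "fst q = shadow D s"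
    using crossing_strands[OF s] by metis
  then obtain u where u: "q = curve D u" by auto
  define n where "n = real (length D)"
  have n: "n > 0" using period_pos by (simp add: n_def)
  define t where "t = u + of_int (- \<lfloor>(u - s) / n\<rfloor>) * n"
  have ct: "curve D t = q" unfolding t_def n_def u by (rule curve_periodic)
  have "s \<le> t" "t < s + n"
    using floor_divide_lower[OF n, of "u - s"] floor_divide_upper[OF n, of "u - s"]
    by (auto simp: t_def algebra_simps)
  moreover have "t \<noteq> s" using ct q by auto
  moreover have "shadow D t = shadow D s" using ct q by (simp add: shadow_def)
  ultimately show ?thesis using that[of t] by (simp add: n_def)
qed

text \<open>
  Each of the finitely many crossings has two strands, and a strand passes once in a period.
\<close>
lemma finite_crossing_times_period: "finite (crossing_times D \<inter> {a..<a + real (length D)})"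
proof (rule inj_on_finite)
  let ?F = "\<Union>x\<in>crossings D. {p \<in> range (curve D). fst p = x}"
  show "finite ?F"
    using D unfolding knot_diagram_def by (intro finite_UN_I) (auto intro: card_ge_0_finite)
  show "curve D ` (crossing_times D \<inter> {a..<a + real (length D)}) \<subseteq> ?F"
    by (auto simp: crossing_times_def shadow_def)
  show "inj_on (curve D) (crossing_times D \<inter> {a..<a + real (length D)})"
  proof (rule inj_onI)
    fix s t assume st: "s \<in> crossing_times D \<inter> {a..<a + real (length D)}"
      "t \<in> crossing_times D \<inter> {a..<a + real (length D)}" "curve D s = curve D t"
    then obtain k :: int where k: "t = s + of_int k * real (length D)"
      using curve_eq_iff[OF knot] by blast
    then have "\<bar>of_int k * real (length D)\<bar> < 1 * real (length D)" using st by auto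
    then have "\<bar>real_of_int k\<bar> < 1"
      unfolding abs_mult using period_pos by simp
    then have "k = 0" by linarith
    then show "s = t" using k by simp
  qed
qed

lemma finite_crossing_times: "finite (crossing_times D \<inter> {a..b})"
proof -
  have fin: "finite (crossing_times D \<inter> {a..<a + real m * real (length D)})" for m
  proof (induction m)
    case (Suc m)
    have "crossing_times D \<inter> {a..<a + real (Suc m) * real (length D)} \<subseteq>
      crossing_times D \<inter> {a..<a + real m * real (length D)} \<union>
      crossing_times D \<inter> {a + real m * real (length D)..<(a + real m * real (length D)) + real (length D)}"
      by (auto simp: algebra_simps)
    then show ?case
      using Suc finite_crossing_times_period by (meson finite_UnI finite_subset)
  qed simp
  obtain m where "b - a < real m * real (length D)"
    using ex_less_of_nat_mult[OF period_pos] by blast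
  then have "crossing_times D \<inter> {a..b} \<subseteq> crossing_times D \<inter> {a..<a + real m * real (length D)}"
    by auto
  then show ?thesis using fin finite_subset by blast
qed

lemma next_crossing:
  assumes "s \<in> crossing_times D"
  obtains t where "consecutive_crossings D s t" "t \<le> s + real (length D)"
proof -
  let ?A = "crossing_times D \<inter> {s<..s + real (length D)}"
  have fin: "finite ?A" by (rule finite_subset[OF _ finite_crossing_times[of s "s + real (length D)"]]) auto
  have "s + real (length D) \<in> ?A" using assms period_pos by auto
  then have ne: "?A \<noteq> {}" by blast
  note m = Min_in[OF fin ne] Min_le[OF fin]
  have "crossing_times D \<inter> {s<..<Min ?A} = {}"
  proof -
    have False if r: "r \<in> crossing_times D" "s < r" "r < Min ?A" for r
    proof -
      have "r \<in> ?A" using r m(1) by auto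
      then show False using m(2)[of r] r(3) by linarith
    qed
    then show ?thesis by auto
  qed
  then show ?thesis using m(1) assms that[of "Min ?A"] by (auto simp: consecutive_crossings_iff)
qed

lemma previous_crossing:
  assumes "t \<in> crossing_times D"
  obtains s where "consecutive_crossings D s t"
proof -
  let ?A = "crossing_times D \<inter> {t - real (length D)..<t}"
  have fin: "finite ?A" by (rule finite_subset[OF _ finite_crossing_times[of "t - real (length D)" t]]) auto
  have "t - real (length D) \<in> ?A" using assms period_pos by auto
  then have ne: "?A \<noteq> {}" by blast
  note m = Max_in[OF fin ne] Max_ge[OF fin]
  have "crossing_times D \<inter> {Max ?A<..<t} = {}"
  proof -
    have False if r: "r \<in> crossing_times D" "Max ?A < r" "r < t" for r
    proof -
      have "r \<in> ?A" using r m(1) by auto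
      then show False using m(2)[of r] r(2) by linarith
    qed
    then show ?thesis by auto
  qed
  then show ?thesis using m(1) assms that[of "Max ?A"] by (auto simp: consecutive_crossings_iff)
qed

lemma crossing_times_nonempty: "crossings D \<noteq> {} \<longleftrightarrow> crossing_times D \<noteq> {}"
proof
  assume "crossings D \<noteq> {}"
  then obtain x t where "x \<in> crossings D" "fst (curve D t) = x" by (auto simp: crossings_def)
  then show "crossing_times D \<noteq> {}" by (auto simp: crossing_times_def shadow_def)
qed (auto simp: crossing_times_def)

lemma first_visit_shift:
  "first_visit D (x + of_int k * real (length D)) c (t + of_int k * real (length D)) \<longleftrightarrow> first_visit D x c t"
proof -
  have *: "first_visit D (x + of_int k * real (length D)) c (t + of_int k * real (length D))"
    if "first_visit D x c t" for x t and k :: int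
  proof -
    have "shadow D r \<noteq> c" if r: "r \<in> {x + of_int k * real (length D)<..<t + of_int k * real (length D)}" for r
    proof -
      have "r + of_int (- k) * real (length D) \<in> {x<..<t}" using r by auto
      then show ?thesis using \<open>first_visit D x c t\<close> shadow_periodic[of D r "- k"]
        unfolding first_visit_def by metis
    qed
    then show ?thesis using that by (auto simp: first_visit_def shadow_periodic)
  qed
  show ?thesis
    using *[of x t k] *[of "x + of_int k * real (length D)" "t + of_int k * real (length D)" "- k"] by auto
qed

text \<open>
  A base point determines its parameter up to periods, and first visits are invariant under them.
\<close>
lemma warping_degree_eq:
  assumes "x \<notin> crossing_times D"
  shows "warping_degree D (shadow D x) = card (warping_after D x)"
proof -
  have "c \<in> warping_after D x" if c: "warping_crossing D (shadow D x) c" for c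
  proof -
    obtain s t where st: "shadow D s = shadow D x" "first_visit D s c t" "under_at D t" "c \<in> crossings D"
      using c unfolding warping_crossing_def first_visit_def by blast
    have "curve D x = curve D s"
    proof (rule ccontr)
      assume "curve D x \<noteq> curve D s"
      then have "shadow D x \<in> crossings D"
        using st(1) unfolding crossings_def shadow_def by fastforce
      then show False using assms by (simp add: crossing_times_def)
    qed
    then obtain k :: int where k: "s = x + of_int k * real (length D)"
      using curve_eq_iff[OF knot] by blast
    define t' where "t' = t + of_int (- k) * real (length D)"
    have t: "t = t' + of_int k * real (length D)" by (simp add: t'_def)
    have "first_visit D x c t'" using st(2) unfolding k t first_visit_shift .
    moreover have "under_at D t'" using st(3) unfolding t under_at_periodic .
    ultimately show ?thesis using st(4) by (auto simp: warping_after_def)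
  qed
  moreover have "warping_crossing D (shadow D x) c" if "c \<in> warping_after D x" for c
    using that unfolding warping_after_def warping_crossing_def first_visit_def by blast
  ultimately have "{c. warping_crossing D (shadow D x) c} = warping_after D x" by blast
  then show ?thesis by (simp add: warping_degree_def)
qed

lemma first_visit_cong:
  assumes "x \<le> y" "crossing_times D \<inter> {x<..y} \<subseteq> {s}" "c \<in> crossings D" "shadow D s \<noteq> c \<or> crossing_times D \<inter> {x<..y} = {}"
  shows "first_visit D x c t \<longleftrightarrow> first_visit D y c t"
proof -
  have away: "shadow D r \<noteq> c" if "r \<in> {x<..y}" for r
    using assms that by (auto simp: crossing_times_def)
  show ?thesis
    unfolding first_visit_def
  proof (intro iffI conjI; elim conjE)
    assume "x < t" "shadow D t = c"
    then show "y < t" using away[of t] by fastforce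
  next
    assume "y < t" "\<forall>r\<in>{y<..<t}. shadow D r \<noteq> c"
    then show "\<forall>r\<in>{x<..<t}. shadow D r \<noteq> c" using away by fastforce
  qed (use assms(1) in auto)
qed

lemma warping_after_cong:
  assumes "x \<le> y" "crossing_times D \<inter> {x<..y} = {}"
  shows "warping_after D x = warping_after D y"
proof -
  have "first_visit D x c t \<longleftrightarrow> first_visit D y c t" if "c \<in> crossings D" for c t
    using assms that by (intro first_visit_cong[where s = x]) auto
  then show ?thesis unfolding warping_after_def by auto
qed

lemma finite_warping_after [simp]: "finite (warping_after D x)"
  using D by (auto simp: warping_after_def knot_diagram_def)

text \<open>
  The heart of the combinatorics: moving the base point forward past a crossing changes the status of
  that crossing and of no other.  Before the passage at time \<open>t\<close> the crossing is met first at
  \<open>t\<close>; afterwards it is met first on its other strand, with over and under interchanged.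
\<close>
lemma warping_after_crossing:
  assumes st: "consecutive_crossings D s t"
  shows "card (warping_after D s) = Suc (card (warping_after D t)) \<and> under_at D t \<or>
    card (warping_after D t) = Suc (card (warping_after D s)) \<and> \<not> under_at D t"
proof -
  define c where "c = shadow D t"
  have st': "s < t" "t \<in> crossing_times D" "crossing_times D \<inter> {s<..t} \<subseteq> {t}"
    using st by (fastforce simp: consecutive_crossings_iff)+
  have c: "c \<in> crossings D" using st' by (simp add: c_def crossing_times_def)
  have rest: "warping_after D s - {c} = warping_after D t - {c}"
    using first_visit_cong[of s t t] st' unfolding warping_after_def c_def by auto
  have "\<forall>r\<in>{s<..<t}. shadow D r \<noteq> c"
    using st c by (auto simp: consecutive_crossings_def)
  then have "first_visit D s c t" using st' by (auto simp: first_visit_def c_def)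
  then have before: "c \<in> warping_after D s \<longleftrightarrow> under_at D t"
    using first_visit_unique c unfolding warping_after_def by blast
  obtain u where u: "t < u" "u < t + real (length D)" "shadow D u = c"
    using second_visit[OF st'(2)] unfolding c_def by blast
  let ?A = "{r \<in> crossing_times D \<inter> {t<..u}. shadow D r = c}"
  have fin: "finite ?A" by (rule finite_subset[OF _ finite_crossing_times[of t u]]) auto
  have "u \<in> ?A" using u c by (auto simp: crossing_times_def)
  then have ne: "?A \<noteq> {}" by blast
  note m = Min_in[OF fin ne] Min_le[OF fin]
  define v where "v = Min ?A"
  have v: "t < v" "v \<le> u" "shadow D v = c" using m by (auto simp: v_def)
  have "first_visit D t c v"
    unfolding first_visit_def
  proof (intro conjI ballI)
    fix r assume r: "r \<in> {t<..<v}"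
    show "shadow D r \<noteq> c"
    proof
      assume "shadow D r = c"
      then have "r \<in> ?A" using r v c by (auto simp: crossing_times_def)
      then show False using m(2)[of r] r unfolding v_def by auto
    qed
  qed (use v in auto)
  then have "c \<in> warping_after D t \<longleftrightarrow> under_at D v"
    using first_visit_unique c unfolding warping_after_def by blast
  moreover have "curve D v \<noteq> curve D t"
  proof
    assume "curve D v = curve D t"
    then obtain k :: int where k: "v = t + of_int k * real (length D)"
      using curve_eq_iff[OF knot] by metis
    then have "0 < of_int k * real (length D)" "of_int k * real (length D) < 1 * real (length D)"
      using v u by auto
    then have "0 < k" "k < 1"
      using period_pos by (simp_all add: zero_less_mult_iff)
    then show False by simp
  qed
  then have "under_at D v \<longleftrightarrow> \<not> under_at D t"
    using under_at_other_strand[OF st'(2)] v by (simp add: c_def)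
  ultimately have after: "c \<in> warping_after D t \<longleftrightarrow> \<not> under_at D t" by simp
  show ?thesis
  proof (cases "under_at D t")
    case True
    then have "warping_after D s = insert c (warping_after D t)" "c \<notin> warping_after D t"
      using rest before after by auto
    then show ?thesis using True by simp
  next
    case False
    then have "warping_after D t = insert c (warping_after D s)" "c \<notin> warping_after D s"
      using rest before after by auto
    then show ?thesis using False by simp
  qed
qed

lemma edge_warping_degree_eq:
  assumes st: "consecutive_crossings D s t"
  shows "edge_warping_degree D (shadow D ` {s<..<t}) = card (warping_after D s)"
proof -
  have "shadow D ((s + t) / 2) \<in> shadow D ` {s<..<t}"
    using st by (auto simp: consecutive_crossings_def)
  then have "(SOME b. b \<in> shadow D ` {s<..<t}) \<in> shadow D ` {s<..<t}" by (rule someI)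
  then obtain x where x: "x \<in> {s<..<t}" "(SOME b. b \<in> shadow D ` {s<..<t}) = shadow D x"
    by blast
  have "x \<notin> crossing_times D" using x st by (auto simp: consecutive_crossings_iff)
  then have "edge_warping_degree D (shadow D ` {s<..<t}) = card (warping_after D x)"
    by (simp add: edge_warping_degree_def x(2) warping_degree_eq)
  also have "warping_after D x = warping_after D s"
    using x st by (intro warping_after_cong[symmetric]) (auto simp: consecutive_crossings_iff)
  finally show ?thesis .
qed

text \<open>
  Up to a period every edge starts at one of finitely many times, and it ends within the
  following period.  Finiteness matters because the sum over an infinite set is \<open>0\<close> by convention.
\<close>
lemma finite_diagram_edges: "finite (diagram_edges D)"
proof (cases "crossings D = {}")
  case False
  define n where "n = real (length D)"
  have n: "n > 0" using period_pos by (simp add: n_def)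
  have "diagram_edges D \<subseteq> (\<lambda>(s, t). shadow D ` {s<..<t}) `
    ((crossing_times D \<inter> {0..n}) \<times> (crossing_times D \<inter> {0..2 * n}))"
  proof
    fix e assume "e \<in> diagram_edges D"
    then obtain s t where st: "e = shadow D ` {s<..<t}" "consecutive_crossings D s t"
      using False by (auto simp: diagram_edges_def)
    define d where "d = of_int (- \<lfloor>s / n\<rfloor>) * n"
    have s: "0 \<le> s + d" "s + d < n"
      using floor_divide_lower[OF n, of s] floor_divide_upper[OF n, of s]
      by (auto simp: d_def algebra_simps)
    obtain t' where t': "consecutive_crossings D s t'" "t' \<le> s + n"
      using next_crossing st(2) unfolding consecutive_crossings_iff n_def by metis
    have "t \<le> t'"
    proof (rule ccontr)
      assume "\<not> t \<le> t'"
      then have "t' \<in> crossing_times D \<inter> {s<..<t}" using t' by (auto simp: consecutive_crossings_iff)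
      then show False using st(2) by (auto simp: consecutive_crossings_iff)
    qed
    then have t: "s < t" "t \<le> s + n" using t'(2) st(2) by (auto simp: consecutive_crossings_iff)
    have per: "shadow D (r + d) = shadow D r" for r unfolding d_def n_def by (rule shadow_periodic)
    have "shadow D ` {s + d<..<t + d} = shadow D ` {s<..<t}"
    proof (intro equalityI subsetI)
      fix x assume "x \<in> shadow D ` {s + d<..<t + d}"
      then obtain r where r: "r \<in> {s + d<..<t + d}" "x = shadow D r" by blast
      then show "x \<in> shadow D ` {s<..<t}"
        using per[of "r - d"] by (intro image_eqI[of _ _ "r - d"]) auto
    next
      fix x assume "x \<in> shadow D ` {s<..<t}"
      then obtain r where r: "r \<in> {s<..<t}" "x = shadow D r" by blast
      then show "x \<in> shadow D ` {s + d<..<t + d}"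
        using per[of r] by (intro image_eqI[of _ _ "r + d"]) auto
    qed
    moreover have "s + d \<in> crossing_times D \<inter> {0..n}" "t + d \<in> crossing_times D \<inter> {0..2 * n}"
      using st(2) s t per by (auto simp: consecutive_crossings_def crossing_times_def)
    ultimately show "e \<in> (\<lambda>(s, t). shadow D ` {s<..<t}) `
      ((crossing_times D \<inter> {0..n}) \<times> (crossing_times D \<inter> {0..2 * n}))"
      unfolding st(1) by (intro image_eqI[of _ _ "(s + d, t + d)"]) auto
  qed
  then show ?thesis using finite_crossing_times by (meson finite_SigmaI finite_imageI finite_subset)
qed (simp add: diagram_edges_def)

text \<open>
  The coefficients count edges, so no term cancels.
\<close>
lemma warping_polynomial_support:
  "{k. coeff (warping_polynomial D) k \<noteq> 0} = edge_warping_degree D ` diagram_edges D"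
proof -
  have "coeff (warping_polynomial D) k = int (card {e \<in> diagram_edges D. edge_warping_degree D e = k})" for k
    unfolding warping_polynomial_def
    by (simp add: coeff_sum sum.If_cases[OF finite_diagram_edges] Int_def)
  then show ?thesis using finite_diagram_edges by (auto simp: card_eq_0_iff)
qed

lemma crossingless_span:
  assumes "crossings D = {}" shows "diagram_span D = 0"
  unfolding diagram_span_def warping_polynomial_support using assms by (simp add: diagram_edges_def)

text \<open>
  Each edge is represented by the crossing time at which it starts.
\<close>
lemma diagram_span_eq:
  assumes "crossings D \<noteq> {}"
  defines "A \<equiv> (\<lambda>s. card (warping_after D s)) ` crossing_times D"
  shows "diagram_span D = Max A - Min A" "finite A"
proof -
  have "edge_warping_degree D ` diagram_edges D = A"
  proof (intro equalityI subsetI)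
    fix k assume "k \<in> edge_warping_degree D ` diagram_edges D"
    then show "k \<in> A"
      using assms(1) edge_warping_degree_eq
      by (auto simp: diagram_edges_def A_def consecutive_crossings_iff)
  next
    fix k assume "k \<in> A"
    then obtain s where s: "s \<in> crossing_times D" "k = card (warping_after D s)" by (auto simp: A_def)
    obtain t where st: "consecutive_crossings D s t" using next_crossing[OF s(1)] by blast
    show "k \<in> edge_warping_degree D ` diagram_edges D"
    proof (rule image_eqI)
      show "k = edge_warping_degree D (shadow D ` {s<..<t})"
        using edge_warping_degree_eq[OF st] s by simp
      show "shadow D ` {s<..<t} \<in> diagram_edges D"
        using st assms(1) by (auto simp: diagram_edges_def)
    qed
  qed
  then show "diagram_span D = Max A - Min A" "finite A"
    unfolding diagram_span_def warping_polynomial_support using finite_diagram_edges by auto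
qed

lemma degree_difference_le_span:
  assumes "s \<in> crossing_times D" "t \<in> crossing_times D"
  shows "card (warping_after D s) \<le> card (warping_after D t) + diagram_span D"
proof -
  define A where "A = (\<lambda>s. card (warping_after D s)) ` crossing_times D"
  have ne: "crossings D \<noteq> {}" using assms crossing_times_nonempty by blast
  have "card (warping_after D s) \<le> Max A" "Min A \<le> card (warping_after D t)"
    using diagram_span_eq(2)[OF ne] assms unfolding A_def by (auto intro!: Max_ge Min_le)
  then show ?thesis using diagram_span_eq(1)[OF ne] unfolding A_def by linarith
qed

lemma span_zero_iff: "diagram_span D = 0 \<longleftrightarrow> crossings D = {}"
proof
  assume z: "diagram_span D = 0"
  show "crossings D = {}"
  proof (rule ccontr)
    assume "crossings D \<noteq> {}"
    then obtain s where s: "s \<in> crossing_times D" using crossing_times_nonempty by blast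
    obtain t where st: "consecutive_crossings D s t" using next_crossing[OF s] by blast
    then have "t \<in> crossing_times D" by (simp add: consecutive_crossings_iff)
    then have "card (warping_after D s) = card (warping_after D t)"
      using degree_difference_le_span[of s t] degree_difference_le_span[of t s] s z by simp
    then show False using warping_after_crossing[OF st] by linarith
  qed
qed (rule crossingless_span)

text \<open>
  Two passages of the same kind in succession would change the warping degree by \<open>2\<close>.
\<close>
lemma span_one_alternating:
  assumes "diagram_span D = 1"
  shows "alternating_diagram D"
proof -
  have "under_at D s \<longleftrightarrow> \<not> under_at D t" if st: "consecutive_crossings D s t" for s t
  proof -
    have s: "s \<in> crossing_times D" "t \<in> crossing_times D" using st by (simp_all add: consecutive_crossings_iff)
    obtain r where r: "consecutive_crossings D r s" using previous_crossing[OF s(1)] by blast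
    then have "r \<in> crossing_times D" by (simp add: consecutive_crossings_iff)
    then have "card (warping_after D r) \<le> card (warping_after D t) + 1"
      "card (warping_after D t) \<le> card (warping_after D r) + 1"
      using degree_difference_le_span s assms by metis+
    then show ?thesis using warping_after_crossing[OF r] warping_after_crossing[OF st] by linarith
  qed
  then show ?thesis using D by (simp add: alternating_diagram_def)
qed

text \<open>
  When over and under alternate, the rises and falls of the warping degree cancel: its value on
  an edge, plus one if the edge starts at an under-crossing, is the same for all edges.
\<close>
lemma alternating_span_le_one:
  assumes "alternating_diagram D"
  shows "diagram_span D \<le> 1"
proof (cases "crossings D = {}")
  case False
  \<comment> \<open>One more than the degree if the edge starts at an under-crossing, to undo the drop that this caused.\<close>
  define \<phi> where "\<phi> s = card (warping_after D s) + (if under_at D s then 1 else 0)" for s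
  have step: "\<phi> s = \<phi> t" if st: "consecutive_crossings D s t" for s t
    using warping_after_crossing[OF st] assms st by (auto simp: \<phi>_def alternating_diagram_def)
  have const: "s \<le> t \<Longrightarrow> s \<in> crossing_times D \<Longrightarrow> t \<in> crossing_times D \<Longrightarrow> \<phi> s = \<phi> t" for s t
  proof (induction "card (crossing_times D \<inter> {s<..t})" arbitrary: s rule: less_induct)
    case less
    show ?case
    proof (cases "s = t")
      case False
      obtain u where u: "consecutive_crossings D s u" using next_crossing[OF less.prems(2)] by blast
      have u': "s < u" "u \<in> crossing_times D" "u \<le> t"
        using u False less.prems by (fastforce simp: consecutive_crossings_iff)+
      have "finite (crossing_times D \<inter> {s<..t})"
        by (rule finite_subset[OF _ finite_crossing_times[of s t]]) auto
      moreover have "crossing_times D \<inter> {u<..t} \<subset> crossing_times D \<inter> {s<..t}"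
        using u' by auto
      ultimately have "\<phi> u = \<phi> t"
        using u' less by (intro less.hyps) (auto intro: psubset_card_mono)
      then show ?thesis using step[OF u] by simp
    qed simp
  qed
  obtain s0 where s0: "s0 \<in> crossing_times D" using False crossing_times_nonempty by blast
  have "\<phi> s = \<phi> s0" if "s \<in> crossing_times D" for s
    using const[OF _ that s0] const[OF _ s0 that] by (metis linear)
  moreover have "card (warping_after D s) \<le> \<phi> s \<and> \<phi> s \<le> card (warping_after D s) + 1" for s
    by (simp add: \<phi>_def)
  ultimately have bound: "card (warping_after D s) \<le> \<phi> s0 \<and> \<phi> s0 \<le> card (warping_after D s) + 1"
    if "s \<in> crossing_times D" for s
    using that by metis
  define A where "A = (\<lambda>s. card (warping_after D s)) ` crossing_times D"
  have A: "finite A" "A \<noteq> {}" using diagram_span_eq(2)[OF False] s0 by (auto simp: A_def)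
  have "k \<le> \<phi> s0" "\<phi> s0 - 1 \<le> k" if "k \<in> A" for k
    using that bound by (auto simp: A_def le_diff_conv)
  then have "Max A \<le> \<phi> s0" "\<phi> s0 - 1 \<le> Min A"
    using Max_in[OF A] Min_in[OF A] by blast+
  then show ?thesis using diagram_span_eq(1)[OF False] unfolding A_def by linarith
qed (simp add: crossingless_span)

end


section \<open>The span of a knot\<close>

theorem theorem4p2:
  fixes K :: "space list"
  assumes "polygonal_knot K"
  shows "(trivial_knot K \<longleftrightarrow> knot_span K = 0) \<and>
         (\<not> trivial_knot K \<and> alternating_knot K \<longleftrightarrow> knot_span K = 1)"
proof -
  have span_le: "knot_span K \<le> enat n \<longleftrightarrow> (\<exists>D. diagram_of D K \<and> diagram_span D \<le> n)" for n
  proof -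
    have "knot_span K \<le> enat n \<longleftrightarrow> knot_span K < enat (Suc n)"
      by (cases "knot_span K") auto
    then show ?thesis by (auto simp: knot_span_def INF_less_iff less_Suc_eq_le)
  qed
  have trivial: "trivial_knot K \<longleftrightarrow> knot_span K = 0"
    using span_le[of 0] span_zero_iff trivial_knot_iff_crossingless_diagram[of K]
    unfolding diagram_of_def zero_enat_def[symmetric] by (metis le_zero_eq)
  have "knot_span K = 1 \<longleftrightarrow> knot_span K \<noteq> 0 \<and> knot_span K \<le> enat 1"
    by (cases "knot_span K") (auto simp: one_enat_def zero_enat_def)
  moreover have "alternating_knot K \<longleftrightarrow> knot_span K \<le> enat 1" if nt: "\<not> trivial_knot K"
  proof
    assume "alternating_knot K"
    then show "knot_span K \<le> enat 1"
      using alternating_span_le_one unfolding span_le alternating_knot_def diagram_of_def by blast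
  next
    assume "knot_span K \<le> enat 1"
    then obtain D where D: "diagram_of D K" "diagram_span D \<le> 1" by (auto simp: span_le)
    then have "knot_diagram D" by (simp add: diagram_of_def)
    moreover have "diagram_span D \<noteq> 0"
      using D nt span_zero_iff[OF \<open>knot_diagram D\<close>] trivial_knot_iff_crossingless_diagram by blast
    ultimately have "alternating_diagram D" using D(2) by (intro span_one_alternating) auto
    then show "alternating_knot K" using D(1) by (auto simp: alternating_knot_def)
  qed
  ultimately show ?thesis using trivial by blast
qed

end
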